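(* Let $f\in\mathcal D$ have negative spectrum. Then: (1) for every $t>\Theta_f$, $\sup_{w\in\overline\Omega}\mathcal L_t\mathbb 1(w)<+\infty$, and for every $\tilde\gamma\in(0,1)$ and $p>1$ with $\frac1p<\frac t{\Theta_f}-1$ there is $C_{p,t}$ with $\mathcal L_t\mathbb 1(w)\le C_{p,t}(\log|w|)^{-1/p}$ for all $|w|>e^{\tilde\gamma}$; (2) for every $t<\Theta_f$, the series defining $\mathcal L_t\mathbb 1(w)$ diverges at every point $w\in\Omega$.
   Context: $\mathbb D=\{|z|<1\}$, $\mathbb D^*=\{|z|>1\}$, $\mathcal H=\{\Re\xi>0\}$, $Q_T=\{0<\Re\xi<4T,|\Im\xi|<4T\}$. Class $\mathcal D$: either an entire $f$ with $S(f)$ (closure of critical and finite asymptotic values) in $\mathbb D$ and finitely many components $\Omega_1,\dots,\Omega_N$ of $f^{-1}(\mathbb D^* )$ ($f=\exp\circ\tau_j$ on $\Omega_j$, $\tau_j:\Omega_j\to\mathcal H$ conformal), or a model function $f=e^{\tau_j}$ on a finite disjoint union $\Omega=\bigcup\Omega_j$ of unbounded simply connected domains with conformal $\tau_j$ onto $\mathcal H$ whose inverses $\varphi_j$ satisfy $|\varphi_j(\xi_n)|\to\infty$ as $|\xi_n|\to\infty$; in both cases $\overline\Omega\cap\overline{\mathbb D}=\emptyset$ and for each $j$ there is $M$ with $|\varphi_j(\xi)|\le M|\varphi_j(\xi')|$ for $\xi,\xi'\in Q_T\setminus Q_{T/8}$, $T$ large. Spectrum: $\varphi_{j,T}(\xi)=\varphi_j(T\xi)/|\varphi_j(T)|$,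 $\beta_h(r,t)=\log\int_I|h'(r+iy)|^tdy/\log(1/r)$ with $I=[-2,-1]\cup[1,2]$, $\beta_{\infty,j}(t)=\limsup_{T\to\infty}\beta_{\varphi_{j,T}}(1/T,t)$, $b_{\infty,j}(t)=\beta_{\infty,j}(t)-t+1$, $\Theta_f=\max_j$(smallest positive zero of $b_{\infty,j}$), $b_\infty=\max_jb_{\infty,j}$; negative spectrum: $b_\infty(t)<0$ for all $t>\Theta_f$. $\mathcal L_t\mathbb 1(w)=\sum_{z\in f^{-1}(w)}|f'(z)|_1^{-t}$, $|f'(z)|_1=|f'(z)||z|/|f(z)|$. *)

theory Defs
  imports "HOL-Analysis.Analysis"
begin

definition right_half_plane :: "complex set" where
  "right_half_plane = {\<xi>. Re \<xi> > 0}"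

definition Qsq :: "real \<Rightarrow> complex set" where
  "Qsq T = {\<xi>. 0 < Re \<xi> \<and> Re \<xi> < 4 * T \<and> \<bar>Im \<xi>\<bar> < 4 * T}"

definition phi_map :: "(nat \<Rightarrow> complex set) \<Rightarrow> (nat \<Rightarrow> complex \<Rightarrow> complex) \<Rightarrow> nat \<Rightarrow> complex \<Rightarrow> complex" where
  "phi_map \<Omega> \<tau> j = inv_into (\<Omega> j) (\<tau> j)"

definition critical_values :: "(complex \<Rightarrow> complex) \<Rightarrow> complex set" where
  "critical_values f = {f z | z. deriv f z = 0}"

definition asymptotic_values :: "(complex \<Rightarrow> complex) \<Rightarrow> complex set" where
  "asymptotic_values f = {a. \<exists>\<gamma>::real \<Rightarrow> complex. continuous_on {0..<1} \<gamma> \<and>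
      filterlim (\<lambda>s. norm (\<gamma> s)) at_top (at_left 1) \<and>
      ((\<lambda>s. f (\<gamma> s)) \<longlongrightarrow> a) (at_left 1)}"

definition singular_set :: "(complex \<Rightarrow> complex) \<Rightarrow> complex set" where
  "singular_set f = closure (critical_values f \<union> asymptotic_values f)"

definition class_D_common ::
  "(complex \<Rightarrow> complex) \<Rightarrow> nat \<Rightarrow> (nat \<Rightarrow> complex set) \<Rightarrow> (nat \<Rightarrow> complex \<Rightarrow> complex) \<Rightarrow> bool" where
  "class_D_common f N \<Omega> \<tau> \<longleftrightarrow>
     0 < N \<and>
     (\<forall>j<N. open (\<Omega> j) \<and> connected (\<Omega> j) \<and> simply_connected (\<Omega> j) \<and> \<not> bounded (\<Omega> j) \<and>
        \<tau> j holomorphic_on \<Omega> j \<and> inj_on (\<tau> j) (\<Omega> j) \<and> \<tau> j ` \<Omega> j = right_half_plane \<and>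
        (\<forall>z\<in>\<Omega> j. f z = exp (\<tau> j z))) \<and>
     (\<forall>i<N. \<forall>j<N. i \<noteq> j \<longrightarrow> \<Omega> i \<inter> \<Omega> j = {}) \<and>
     closure (\<Union>j<N. \<Omega> j) \<inter> cball 0 1 = {} \<and>
     (\<forall>j<N. \<exists>M::real. \<exists>T0::real. \<forall>T\<ge>T0. \<forall>\<xi> \<xi>'.
        \<xi> \<in> Qsq T - Qsq (T / 8) \<longrightarrow> \<xi>' \<in> Qsq T - Qsq (T / 8) \<longrightarrow>
        norm (phi_map \<Omega> \<tau> j \<xi>) \<le> M * norm (phi_map \<Omega> \<tau> j \<xi>'))"

definition entire_class_D ::
  "(complex \<Rightarrow> complex) \<Rightarrow> nat \<Rightarrow> (nat \<Rightarrow> complex set) \<Rightarrow> (nat \<Rightarrow> complex \<Rightarrow> complex) \<Rightarrow> bool" where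
  "entire_class_D f N \<Omega> \<tau> \<longleftrightarrow>
     f holomorphic_on UNIV \<and>
     singular_set f \<subseteq> ball 0 1 \<and>
     inj_on \<Omega> {..<N} \<and>
     \<Omega> ` {..<N} = components (f -` {w. norm w > 1}) \<and>
     class_D_common f N \<Omega> \<tau>"

text \<open>Model functions in class D (defined on the union of the Omega j only).\<close>
definition model_class_D ::
  "(complex \<Rightarrow> complex) \<Rightarrow> nat \<Rightarrow> (nat \<Rightarrow> complex set) \<Rightarrow> (nat \<Rightarrow> complex \<Rightarrow> complex) \<Rightarrow> bool" where
  "model_class_D f N \<Omega> \<tau> \<longleftrightarrow>
     class_D_common f N \<Omega> \<tau> \<and>
     (\<forall>j<N. \<forall>\<xi>s::nat \<Rightarrow> complex. (\<forall>n. \<xi>s n \<in> right_half_plane) \<longrightarrow>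
        filterlim (\<lambda>n. norm (\<xi>s n)) at_top sequentially \<longrightarrow>
        filterlim (\<lambda>n. norm (phi_map \<Omega> \<tau> j (\<xi>s n))) at_top sequentially)"

definition rescaled_phi :: "(nat \<Rightarrow> complex set) \<Rightarrow> (nat \<Rightarrow> complex \<Rightarrow> complex) \<Rightarrow> nat \<Rightarrow> real \<Rightarrow> complex \<Rightarrow> complex" where
  "rescaled_phi \<Omega> \<tau> j T \<xi> =
     phi_map \<Omega> \<tau> j (of_real T * \<xi>) / of_real (norm (phi_map \<Omega> \<tau> j (of_real T)))"

definition beta_int :: "(complex \<Rightarrow> complex) \<Rightarrow> real \<Rightarrow> real \<Rightarrow> real" where
  "beta_int h r t =
     ln (integral ({-2..-1} \<union> {1..2}) (\<lambda>y. norm (deriv h (Complex r y)) powr t)) / ln (1 / r)"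

definition beta_infty :: "(nat \<Rightarrow> complex set) \<Rightarrow> (nat \<Rightarrow> complex \<Rightarrow> complex) \<Rightarrow> nat \<Rightarrow> real \<Rightarrow> ereal" where
  "beta_infty \<Omega> \<tau> j t = Limsup at_top (\<lambda>T::real. ereal (beta_int (rescaled_phi \<Omega> \<tau> j T) (1 / T) t))"

definition b_infty_j :: "(nat \<Rightarrow> complex set) \<Rightarrow> (nat \<Rightarrow> complex \<Rightarrow> complex) \<Rightarrow> nat \<Rightarrow> real \<Rightarrow> ereal" where
  "b_infty_j \<Omega> \<tau> j t = beta_infty \<Omega> \<tau> j t - ereal t + 1"

definition b_infty :: "nat \<Rightarrow> (nat \<Rightarrow> complex set) \<Rightarrow> (nat \<Rightarrow> complex \<Rightarrow> complex) \<Rightarrow> real \<Rightarrow> ereal" where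
  "b_infty N \<Omega> \<tau> t = Max ((\<lambda>j. b_infty_j \<Omega> \<tau> j t) ` {..<N})"

definition theta_j :: "(nat \<Rightarrow> complex set) \<Rightarrow> (nat \<Rightarrow> complex \<Rightarrow> complex) \<Rightarrow> nat \<Rightarrow> real" where
  "theta_j \<Omega> \<tau> j = (LEAST t::real. 0 < t \<and> b_infty_j \<Omega> \<tau> j t = 0)"

definition Theta :: "nat \<Rightarrow> (nat \<Rightarrow> complex set) \<Rightarrow> (nat \<Rightarrow> complex \<Rightarrow> complex) \<Rightarrow> real" where
  "Theta N \<Omega> \<tau> = Max ((\<lambda>j. theta_j \<Omega> \<tau> j) ` {..<N})"

text \<open>The smallest positive zeros exist (implicit in the definition of Theta_f).\<close>
definition spectrum_well_defined :: "nat \<Rightarrow> (nat \<Rightarrow> complex set) \<Rightarrow> (nat \<Rightarrow> complex \<Rightarrow> complex) \<Rightarrow> bool" where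
  "spectrum_well_defined N \<Omega> \<tau> \<longleftrightarrow>
     (\<forall>j<N. \<exists>t0::real. 0 < t0 \<and> b_infty_j \<Omega> \<tau> j t0 = 0 \<and>
        (\<forall>s. 0 < s \<and> b_infty_j \<Omega> \<tau> j s = 0 \<longrightarrow> t0 \<le> s))"

definition negative_spectrum :: "nat \<Rightarrow> (nat \<Rightarrow> complex set) \<Rightarrow> (nat \<Rightarrow> complex \<Rightarrow> complex) \<Rightarrow> bool" where
  "negative_spectrum N \<Omega> \<tau> \<longleftrightarrow>
     spectrum_well_defined N \<Omega> \<tau> \<and> (\<forall>t > Theta N \<Omega> \<tau>. b_infty N \<Omega> \<tau> t < 0)"

definition log_deriv_norm :: "(complex \<Rightarrow> complex) \<Rightarrow> complex \<Rightarrow> real" where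
  "log_deriv_norm f z = norm (deriv f z) * norm z / norm (f z)"

text \<open>Terms of the series L_t 1(w); A is the domain of f (UNIV or the union of Omega j).\<close>
definition transfer_term :: "(complex \<Rightarrow> complex) \<Rightarrow> real \<Rightarrow> complex \<Rightarrow> real" where
  "transfer_term f t z = log_deriv_norm f z powr (- t)"

definition preimage_in :: "complex set \<Rightarrow> (complex \<Rightarrow> complex) \<Rightarrow> complex \<Rightarrow> complex set" where
  "preimage_in A f w = {z \<in> A. f z = w}"

definition transfer_op :: "complex set \<Rightarrow> (complex \<Rightarrow> complex) \<Rightarrow> real \<Rightarrow> complex \<Rightarrow> real" where
  "transfer_op A f t w = infsum (transfer_term f t) (preimage_in A f w)"

end

theory Submission
  imports Defs "HOL-Complex_Analysis.Complex_Analysis"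
begin

text \<open>
  Write \<open>\<phi>\<^sub>j = exp \<psi>\<^sub>j\<close> on the right half-plane. The terms of the series are \<open>|\<psi>\<^sub>j'(\<xi>)| ^ t\<close> at the
  logarithms \<open>\<xi>\<close> of \<open>w\<close>. Since \<open>exp \<circ> \<psi>\<^sub>j\<close> is injective, Bloch's theorem gives
  \<open>|\<psi>\<^sub>j'(\<xi>)| \<le> 12\<pi> / Re \<xi>\<close> and a pre-Schwarzian bound, hence a Harnack inequality for \<open>|\<psi>\<^sub>j'|\<close>. So a series
  with exponent \<open>s\<close> converges iff \<open>|\<psi>\<^sub>j'| ^ s\<close> is integrable on the line \<open>Re \<xi> = 1\<close>, and the comparability of
  \<open>|\<phi>\<^sub>j|\<close> on \<open>Q\<^sub>T - Q\<^sub>T\<^sub>/\<^sub>8\<close> turns the dyadic pieces of this integral into the spectral integrals: negative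
  spectrum at \<open>s\<close> makes it finite.

  Uniformity on half-planes comes from Phragmen-Lindelof, applied to \<open>\<Sum>k. \<epsilon>\<^sub>k G(\<xi> + 2\<pi>ik)\<close> with \<open>G\<close> a branch of
  \<open>\<psi>\<^sub>j' ^ s\<close> and unimodular \<open>\<epsilon>\<^sub>k\<close>. Finiteness at \<open>s = 1\<close> would make \<open>\<phi>\<^sub>j(1 + iy)\<close> converge, so \<open>\<Theta> \<ge> 1\<close>;
  hence \<open>s = t - 1/p > \<Theta>\<close>, and the surplus exponent \<open>1/p\<close> yields the decay.

  Conversely, convergence at some \<open>t\<close> below \<open>\<Theta> = \<theta>\<^sub>j\<close> gives \<open>b\<^sub>j(t) \<le> 0\<close>; as \<open>b\<^sub>j(0) = 1\<close> and \<open>b\<^sub>j\<close> is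
  Lipschitz, it vanishes before \<open>\<theta>\<^sub>j\<close>, a contradiction.
\<close>

section \<open>Distortion of univalent functions\<close>

text \<open>By Bloch's theorem the image of the disc under \<open>h\<close> contains a disc of
  radius \<open>R * norm (deriv h a) / 12\<close>. If this radius exceeded pi, that disc would
  contain two points differing by \<open>2 * pi * \<i>\<close>, where \<open>exp\<close> takes the
  same value.\<close>

lemma deriv_le_of_exp_inj:
  assumes holo: "h holomorphic_on ball a R" and R: "0 < R"
    and inj: "inj_on (\<lambda>z. exp (h z)) (ball a R)"
  shows "norm (deriv h a) \<le> 12 * pi / R"
proof (rule ccontr)
  define r where "r = R * norm (deriv h a) / 12"
  assume "\<not> norm (deriv h a) \<le> 12 * pi / R"
  then have r: "pi < r"
    using R by (simp add: r_def field_simps)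
  obtain b where b: "ball b r \<subseteq> h ` ball a R"
    using Bloch[OF holo R, of r] r_def by auto
  have "b + \<i> * pi \<in> ball b r" "b - \<i> * pi \<in> ball b r"
    using r by (auto simp: dist_norm norm_mult)
  then have "b + \<i> * pi \<in> h ` ball a R" "b - \<i> * pi \<in> h ` ball a R"
    using b by blast+
  then obtain z1 z2 where z: "z1 \<in> ball a R" "z2 \<in> ball a R" "h z1 = b + \<i> * pi" "h z2 = b - \<i> * pi"
    by (auto simp: image_iff)
  have "exp (h z1) = exp (h z2)"
    unfolding z exp_add exp_diff by (simp add: exp_minus mult.commute)
  then have "z1 = z2"
    by (rule inj_onD[OF inj]) (use z in auto)
  then have "b + \<i> * pi = b - \<i> * pi"
    using z by simp
  then show False
    by (simp add: complex_eq_iff)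
qed

text \<open>A zero-free \<open>F\<close> on a disc has a holomorphic logarithm \<open>h\<close>, and
  \<open>deriv F / F = deriv h\<close>.\<close>

lemma univalent_nonvanishing_deriv_le:
  assumes holo: "F holomorphic_on ball a R" and R: "0 < R"
    and inj: "inj_on F (ball a R)" and nz: "\<And>z. z \<in> ball a R \<Longrightarrow> F z \<noteq> 0"
  shows "norm (deriv F a / F a) \<le> 12 * pi / R"
proof -
  obtain h where h: "h holomorphic_on ball a R" "\<And>z. z \<in> ball a R \<Longrightarrow> exp (h z) = F z"
    using holomorphic_logarithm_exists[OF convex_ball open_ball holo nz, of a] R by auto
  have "inj_on (\<lambda>z. exp (h z)) (ball a R)"
    using inj h(2) by (simp add: inj_on_def)
  then have "norm (deriv h a) \<le> 12 * pi / R"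
    using deriv_le_of_exp_inj[OF h(1) R] by simp
  moreover have "deriv F a = F a * deriv h a"
  proof -
    have "(h has_field_derivative deriv h a) (at a)"
      using h(1) R by (simp add: holomorphic_derivI)
    then have "((\<lambda>z. exp (h z)) has_field_derivative exp (h a) * deriv h a) (at a)"
      by (auto intro!: derivative_eq_intros)
    then have "(F has_field_derivative exp (h a) * deriv h a) (at a)"
      by (rule has_field_derivative_transform_within_open[where S = "ball a R"]) (use h R in auto)
    then show ?thesis
      using h(2)[of a] R by (simp add: DERIV_imp_deriv)
  qed
  ultimately show ?thesis
    using nz[of a] R by simp
qed

text \<open>A pre-Schwarzian bound. With the divided difference \<open>q\<close> of \<open>F\<close>
  at \<open>a\<close> one has \<open>F''(a) = 2 q'(a)\<close>, so \<open>L = q'/q\<close> has to be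
  bounded at \<open>a\<close>. If \<open>z\<close> is at distance \<open>R / 2\<close> from
  \<open>a\<close>, then \<open>F - F a\<close> is univalent and zero-free on
  \<open>ball z (R / 2)\<close>, and the previous bound applies to
  \<open>F' / (F - F a) = L + 1 / (z - a)\<close>.\<close>

lemma univalent_second_deriv_le:
  assumes holo: "F holomorphic_on ball a R" and R: "0 < R" and inj: "inj_on F (ball a R)"
  shows "norm (deriv (deriv F) a) \<le> (48 * pi + 4) / R * norm (deriv F a)"
proof -
  let ?B = "ball a R"
  define q where "q = (\<lambda>z. if z = a then deriv F a else (F z - F a) / (z - a))"
  have q_holo: "q holomorphic_on ?B"
    unfolding q_def by (rule pole_lemma_open[OF holo open_ball])
  have F_eq: "F z = F a + (z - a) * q z" for z
    by (simp add: q_def)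
  have Fd: "deriv F z \<noteq> 0" if "z \<in> ?B" for z
    using holomorphic_injective_imp_regular[OF holo open_ball inj that] .
  have q_nz: "q z \<noteq> 0" if "z \<in> ?B" for z
    using that R Fd[of a] inj by (auto simp: q_def dest: inj_onD)
  have q_der: "(q has_field_derivative deriv q z) (at z)" if "z \<in> ?B" for z
    using q_holo that by (simp add: holomorphic_derivI)
  have F_der: "deriv F z = q z + (z - a) * deriv q z" if "z \<in> ?B" for z
  proof -
    have "((\<lambda>z. F a + (z - a) * q z) has_field_derivative q z + (z - a) * deriv q z) (at z)"
      using q_der[OF that] by (auto intro!: derivative_eq_intros)
    then show ?thesis
      by (simp add: DERIV_imp_deriv flip: F_eq)
  qed
  have dq_holo: "deriv q holomorphic_on ?B"
    by (intro holomorphic_deriv q_holo open_ball)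
  have dq_der: "(deriv q has_field_derivative deriv (deriv q) z) (at z)" if "z \<in> ?B" for z
    using dq_holo that by (simp add: holomorphic_derivI)
  have F_der2: "deriv (deriv F) a = 2 * deriv q a"
  proof -
    have "((\<lambda>z. q z + (z - a) * deriv q z) has_field_derivative 2 * deriv q a) (at a)"
      using q_der[of a] dq_der[of a] R by (auto intro!: derivative_eq_intros)
    then have "(deriv F has_field_derivative 2 * deriv q a) (at a)"
      by (rule has_field_derivative_transform_within_open[where S = ?B]) (use F_der R in auto)
    then show ?thesis
      by (rule DERIV_imp_deriv)
  qed
  define L where "L = (\<lambda>z. deriv q z / q z)"
  have L_holo: "L holomorphic_on ?B"
    unfolding L_def by (intro holomorphic_intros dq_holo q_holo) (use q_nz in auto)
  have L_le: "norm (L z) \<le> (24 * pi + 2) / R" if z: "norm (a - z) = R / 2" for z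
  proof -
    have sub: "ball z (R / 2) \<subseteq> ?B"
    proof
      fix x assume "x \<in> ball z (R / 2)"
      then show "x \<in> ?B"
        using z dist_triangle[of a x z] by (auto simp: dist_norm)
    qed
    have zB: "z \<in> ?B"
      using z R by (simp add: dist_norm)
    have za: "z \<noteq> a" using z R by auto
    have "norm (deriv (\<lambda>z. F z - F a) z / (F z - F a)) \<le> 12 * pi / (R / 2)"
    proof (rule univalent_nonvanishing_deriv_le)
      show "(\<lambda>z. F z - F a) holomorphic_on ball z (R / 2)"
        by (intro holomorphic_intros holomorphic_on_subset[OF holo sub])
      show "inj_on (\<lambda>z. F z - F a) (ball z (R / 2))"
        using inj_on_subset[OF inj sub] by (simp add: inj_on_def)
      show "F w - F a \<noteq> 0" if "w \<in> ball z (R / 2)" for w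
      proof
        assume "F w - F a = 0"
        then have "w = a"
          using inj sub that R by (auto dest!: inj_onD)
        then show False
          using that z by (simp add: dist_norm norm_minus_commute)
      qed
    qed (use R in auto)
    moreover have "deriv (\<lambda>z. F z - F a) z = deriv F z"
      using holo zB by (simp add: holomorphic_on_imp_differentiable_at)
    ultimately have 1: "norm (deriv F z / (F z - F a)) \<le> 24 * pi / R"
      by simp
    have "L z = deriv F z / (F z - F a) - 1 / (z - a)"
    proof -
      have "F z - F a = (z - a) * q z"
        using F_eq[of z] by simp
      then show ?thesis
        using q_nz[OF zB] za by (simp add: L_def F_der[OF zB] add_divide_distrib)
    qed
    also have "norm \<dots> \<le> 24 * pi / R + norm (1 / (z - a))"
      using 1 norm_triangle_ineq4[of "deriv F z / (F z - F a)" "1 / (z - a)"] by linarith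
    also have "norm (1 / (z - a)) = 2 / R"
      by (simp add: norm_divide norm_minus_commute[of z] z)
    finally show ?thesis
      by (simp add: add_divide_distrib)
  qed
  \<comment> \<open>The Cauchy estimate of order 0 serves as the maximum principle: it carries the
    bound from the circle to its centre.\<close>
  have "norm ((deriv ^^ 0) L a) \<le> fact 0 * ((24 * pi + 2) / R) / (R / 2) ^ 0"
  proof (rule Cauchy_inequality)
    show "L holomorphic_on ball a (R / 2)"
      by (rule holomorphic_on_subset[OF L_holo]) (use R in auto)
    show "continuous_on (cball a (R / 2)) L"
      by (rule continuous_on_subset[OF holomorphic_on_imp_continuous_on[OF L_holo]]) (use R in auto)
  qed (use R L_le in auto)
  then have "norm (deriv q a) / norm (q a) \<le> (24 * pi + 2) / R"
    by (simp add: L_def norm_divide)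
  then have "norm (deriv q a) \<le> (24 * pi + 2) / R * norm (q a)"
    using q_nz[of a] R by (simp add: pos_divide_le_eq)
  moreover have "q a = deriv F a"
    by (simp add: q_def)
  ultimately have "norm (deriv (deriv F) a) \<le> 2 * ((24 * pi + 2) / R * norm (deriv F a))"
    by (simp add: F_der2 norm_mult)
  also have "\<dots> = (48 * pi + 4) / R * norm (deriv F a)"
    by (simp add: add_divide_distrib distrib_left distrib_right)
  finally show ?thesis .
qed

section \<open>Logarithmic tracts\<close>

lemma open_right_half_plane: "open right_half_plane"
  unfolding right_half_plane_def by (rule open_halfspace_Re_gt)

lemma convex_right_half_plane: "convex right_half_plane"
  unfolding right_half_plane_def by (rule convex_halfspace_Re_gt)

lemma ball_subset_right_half_plane: "ball \<xi> (Re \<xi>) \<subseteq> right_half_plane"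
proof
  fix z assume "z \<in> ball \<xi> (Re \<xi>)"
  then have "Re (\<xi> - z) < Re \<xi>"
    using complex_Re_le_cmod[of "\<xi> - z"] by (simp add: dist_norm)
  then show "z \<in> right_half_plane"
    by (simp add: right_half_plane_def)
qed

text \<open>Phragmen-Lindelof for bounded functions. What counts is that \<open>M\<close> does not
  enter the conclusion: in the application \<open>M\<close> grows with the number of summands, while
  \<open>B\<close> does not.\<close>

lemma half_plane_bounded_maximum:
  fixes S :: "complex \<Rightarrow> complex"
  assumes holo: "S holomorphic_on right_half_plane" and x0: "0 < x0"
    and bdd: "\<And>\<xi>. x0 \<le> Re \<xi> \<Longrightarrow> norm (S \<xi>) \<le> M"
    and bdy: "\<And>\<xi>. Re \<xi> = x0 \<Longrightarrow> norm (S \<xi>) \<le> B"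
    and \<xi>: "x0 \<le> Re \<xi>"
  shows "norm (S \<xi>) \<le> B"
proof -
  have B0: "0 \<le> B"
    using bdy[of "of_real x0"] order_trans[OF norm_ge_zero] by auto
  \<comment> \<open>The maximum principle on large half-discs, applied to \<open>S ^ n / \<xi>\<close>, which vanishes at infinity.\<close>
  have key: "norm (S \<xi>) ^ n \<le> (c ^ n / x0) * norm \<xi>" if c: "0 < c" "B \<le> c" for c n
  proof -
    \<comment> \<open>The first entry puts \<xi> into the half-disc; the second makes
      \<open>M ^ n / R\<close> at most \<open>c ^ n / x0\<close>, which settles the circular
      arc.\<close>
    define R where "R = max (norm \<xi> + 1) (M ^ n * x0 / c ^ n)"
    define D where "D = {z. x0 \<le> Re z} \<inter> cball 0 R"
    have closedD: "closed D"
      unfolding D_def by (intro closed_Int closed_halfspace_Re_ge closed_cball)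
    have sub: "D \<subseteq> right_half_plane"
      using x0 by (auto simp: D_def right_half_plane_def)
    have "(\<lambda>z. S z ^ n / z) holomorphic_on right_half_plane"
      by (intro holomorphic_intros holo) (auto simp: right_half_plane_def)
    then have h: "(\<lambda>z. S z ^ n / z) holomorphic_on D"
      by (rule holomorphic_on_subset) (rule sub)
    have "norm (S \<xi> ^ n / \<xi>) \<le> c ^ n / x0"
    proof (rule maximum_modulus_frontier[where f = "\<lambda>z. S z ^ n / z" and S = D])
      show "(\<lambda>z. S z ^ n / z) holomorphic_on interior D"
        by (rule holomorphic_on_subset[OF h interior_subset])
      show "continuous_on (closure D) (\<lambda>z. S z ^ n / z)"
        using h closedD by (simp add: holomorphic_on_imp_continuous_on)
      show "bounded D"
        unfolding D_def by (simp add: bounded_Int)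
      show "\<xi> \<in> D"
        using \<xi> by (simp add: D_def R_def)
      fix z assume z: "z \<in> frontier D"
      then have zD: "z \<in> D" and "z \<notin> interior D"
        using closedD by (auto simp: frontier_def)
      moreover have "{z. x0 < Re z} \<inter> ball 0 R \<subseteq> interior D"
        by (rule interior_maximal) (auto simp: D_def intro!: open_Int open_halfspace_Re_gt)
      ultimately have "Re z = x0 \<or> norm z = R"
        by (force simp: D_def)
      then show "norm (S z ^ n / z) \<le> c ^ n / x0"
      proof
        assume "Re z = x0"
        then have "norm (S z ^ n) \<le> c ^ n" "x0 \<le> norm z"
          using bdy[of z] c complex_Re_le_cmod[of z] by (auto simp: norm_power intro!: power_mono)
        then show ?thesis
  using x0 c by (simp add: norm_divide frac_le)
      next
        assume "norm z = R"
        moreover have "norm (S z ^ n) \<le> M ^ n"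
          using bdd[of z] zD by (auto simp: D_def norm_power intro!: power_mono)
        moreover have "0 < R"
          by (simp add: R_def less_max_iff_disj add_nonneg_pos)
        ultimately have "norm (S z ^ n / z) \<le> M ^ n / R"
          by (simp add: norm_divide divide_right_mono)
        also have "\<dots> \<le> c ^ n / x0"
        proof -
          have "M ^ n * x0 / c ^ n \<le> R"
            by (simp add: R_def)
          then have "M ^ n * x0 \<le> R * c ^ n"
            using c(1) by (simp add: pos_divide_le_eq)
          then show ?thesis
            using x0 \<open>0 < R\<close> by (simp add: divide_le_eq le_divide_eq mult.commute field_simps)
        qed
        finally show ?thesis .
      qed
    qed
    moreover have "\<xi> \<noteq> 0"
      using \<xi> x0 by auto
    ultimately show ?thesis
      by (simp add: norm_divide norm_power pos_divide_le_eq)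
  qed
  have main: "norm (S \<xi>) \<le> b" if b: "B < b" for b
  proof (rule ccontr)
    assume "\<not> norm (S \<xi>) \<le> b"
    \<comment> \<open>Between \<open>B\<close> and \<open>b\<close>, so that \<open>c\<close> is
      positive even if \<open>B = 0\<close>, and \<open>norm (S \<xi>) / c\<close> exceeds 1; its
      powers would then outgrow the fixed number \<open>norm \<xi> / x0\<close>.\<close>
    define c where "c = (B + b) / 2"
    have c: "0 < c" "c < norm (S \<xi>)" "B \<le> c"
      using b B0 \<open>\<not> norm (S \<xi>) \<le> b\<close> by (auto simp: c_def)
    have "(norm (S \<xi>) / c) ^ n \<le> norm \<xi> / x0" for n
    proof -
      have "norm (S \<xi>) ^ n \<le> (c ^ n / x0) * norm \<xi>"
        using key c by simp
      then show ?thesis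
        using c by (simp add: power_divide pos_divide_le_eq mult.commute)
    qed
    moreover obtain n where "norm \<xi> / x0 < (norm (S \<xi>) / c) ^ n"
      using real_arch_pow[of "norm (S \<xi>) / c"] c by auto
    ultimately show False
      using not_le by blast
  qed
  show ?thesis
    by (rule dense_ge) (rule main)
qed

section \<open>Logarithms of univalent functions on the half-plane: derivative bounds and Harnack
  inequality\<close>

locale log_tract =
  fixes \<psi> :: "complex \<Rightarrow> complex"
  assumes holo: "\<psi> holomorphic_on right_half_plane"
    and exp_inj: "inj_on (\<lambda>\<xi>. exp (\<psi> \<xi>)) right_half_plane"
begin

text \<open>The Eremenko-Lyubich expansion estimate, seen from the inverse branch: the disc of
  radius \<open>Re \<xi>\<close> about \<xi> lies in the half-plane.\<close>

lemma deriv_le: "0 < Re \<xi> \<Longrightarrow> norm (deriv \<psi> \<xi>) \<le> 12 * pi / Re \<xi>"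
  using deriv_le_of_exp_inj[of \<psi> \<xi> "Re \<xi>"] ball_subset_right_half_plane[of \<xi>]
    holomorphic_on_subset[OF holo] inj_on_subset[OF exp_inj] by blast

lemma inj: "inj_on \<psi> right_half_plane"
  using exp_inj by (auto simp: inj_on_def)

lemma deriv_nonzero: "0 < Re \<xi> \<Longrightarrow> deriv \<psi> \<xi> \<noteq> 0"
  using holomorphic_injective_imp_regular[OF holo open_right_half_plane inj]
  by (simp add: right_half_plane_def)

lemma deriv_holo: "deriv \<psi> holomorphic_on right_half_plane"
  by (rule holomorphic_deriv[OF holo open_right_half_plane])

definition \<kappa> :: real where "\<kappa> = 48 * pi + 4"

lemma kappa_pos: "0 < \<kappa>"
  by (simp add: \<kappa>_def add_pos_pos)

lemma second_deriv_le:
  "0 < Re \<xi> \<Longrightarrow> norm (deriv (deriv \<psi>) \<xi>) \<le> \<kappa> / Re \<xi> * norm (deriv \<psi> \<xi>)"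
  using univalent_second_deriv_le[of \<psi> \<xi> "Re \<xi>"] ball_subset_right_half_plane[of \<xi>]
    holomorphic_on_subset[OF holo] inj_on_subset[OF inj] unfolding \<kappa>_def by blast

text \<open>The derivative has no zeros on a convex set. The logarithm \<open>L\<close> serves
  twice: its derivative is the pre-Schwarzian, which yields \<open>harnack\<close>, and
  \<open>exp (s * L)\<close> is a holomorphic power of \<open>deriv \<psi>\<close> with real
  exponent \<open>s\<close>.\<close>

lemma deriv_log:
  obtains L where "L holomorphic_on right_half_plane"
    and "\<And>\<xi>. 0 < Re \<xi> \<Longrightarrow> exp (L \<xi>) = deriv \<psi> \<xi>"
    and "\<And>\<xi>. 0 < Re \<xi> \<Longrightarrow> (L has_field_derivative deriv (deriv \<psi>) \<xi> / deriv \<psi> \<xi>) (at \<xi>)"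
proof -
  obtain L where L: "L holomorphic_on right_half_plane"
    "\<And>\<xi>. \<xi> \<in> right_half_plane \<Longrightarrow> exp (L \<xi>) = deriv \<psi> \<xi>"
    using holomorphic_logarithm_exists[OF convex_right_half_plane open_right_half_plane deriv_holo, of 1]
      deriv_nonzero by (auto simp: right_half_plane_def)
  have "(L has_field_derivative deriv (deriv \<psi>) \<xi> / deriv \<psi> \<xi>) (at \<xi>)" if "0 < Re \<xi>" for \<xi>
  proof -
    have \<xi>: "\<xi> \<in> right_half_plane"
      using that by (simp add: right_half_plane_def)
    have der: "(L has_field_derivative deriv L \<xi>) (at \<xi>)"
      by (rule holomorphic_derivI[OF L(1) open_right_half_plane \<xi>])
    then have "((\<lambda>z. exp (L z)) has_field_derivative exp (L \<xi>) * deriv L \<xi>) (at \<xi>)"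
      by (auto intro!: derivative_eq_intros)
    then have "(deriv \<psi> has_field_derivative exp (L \<xi>) * deriv L \<xi>) (at \<xi>)"
      by (rule has_field_derivative_transform_within_open[OF _ open_right_half_plane \<xi>]) (use L in auto)
    then have "deriv (deriv \<psi>) \<xi> = deriv \<psi> \<xi> * deriv L \<xi>"
      using L(2)[OF \<xi>] by (simp add: DERIV_imp_deriv)
    then show ?thesis
      using der deriv_nonzero[OF that] by simp
  qed
  with L that show thesis
    by (auto simp: right_half_plane_def)
qed

text \<open>On the convex set \<open>Re z \<ge> d\<close> the pre-Schwarzian is at most
  \<open>\<kappa> / d\<close>; integration along the segment bounds the change of \<open>L\<close>,
  whose real part is the logarithm of \<open>norm (deriv \<psi>)\<close>.\<close>

lemma harnack:
  assumes d: "0 < d" and \<xi>: "d \<le> Re \<xi>" "d \<le> Re \<xi>'"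
  shows "norm (deriv \<psi> \<xi>) \<le> exp (\<kappa> / d * norm (\<xi> - \<xi>')) * norm (deriv \<psi> \<xi>')"
proof -
  obtain L where L: "\<And>\<xi>. 0 < Re \<xi> \<Longrightarrow> exp (L \<xi>) = deriv \<psi> \<xi>"
    "\<And>\<xi>. 0 < Re \<xi> \<Longrightarrow> (L has_field_derivative deriv (deriv \<psi>) \<xi> / deriv \<psi> \<xi>) (at \<xi>)"
    using deriv_log by metis
  have "norm (L \<xi> - L \<xi>') \<le> \<kappa> / d * norm (\<xi> - \<xi>')"
  proof (rule field_differentiable_bound)
    show "convex {z. d \<le> Re z}"
      by (rule convex_halfspace_Re_ge)
    fix z assume "z \<in> {z. d \<le> Re z}"
    then have z: "d \<le> Re z" "0 < Re z"
      using d by auto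
    show "(L has_field_derivative deriv (deriv \<psi>) z / deriv \<psi> z) (at z within {z. d \<le> Re z})"
      using L(2)[OF z(2)] by (rule has_field_derivative_at_within)
    have "norm (deriv (deriv \<psi>) z / deriv \<psi> z) \<le> \<kappa> / Re z"
      using second_deriv_le[OF z(2)] deriv_nonzero[OF z(2)] by (simp add: norm_divide pos_divide_le_eq)
    also have "\<dots> \<le> \<kappa> / d"
      using z d kappa_pos by (simp add: frac_le)
    finally show "norm (deriv (deriv \<psi>) z / deriv \<psi> z) \<le> \<kappa> / d" .
  qed (use \<xi> in auto)
  then have "Re (L \<xi>) \<le> \<kappa> / d * norm (\<xi> - \<xi>') + Re (L \<xi>')"
    using complex_Re_le_cmod[of "L \<xi> - L \<xi>'"] by simp
  then have "exp (Re (L \<xi>)) \<le> exp (\<kappa> / d * norm (\<xi> - \<xi>')) * exp (Re (L \<xi>'))"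
    by (simp flip: exp_add)
  then show ?thesis
    using L(1)[of \<xi>, symmetric] L(1)[of \<xi>', symmetric] d \<xi> by simp
qed

lemma harnack_powr:
  assumes d: "0 < d" and \<xi>: "d \<le> Re \<xi>" "d \<le> Re \<xi>'" and r: "norm (\<xi> - \<xi>') \<le> r" and s: "0 \<le> s"
  shows "norm (deriv \<psi> \<xi>) powr s \<le> exp (\<kappa> * r / d * s) * norm (deriv \<psi> \<xi>') powr s"
proof -
  have "norm (deriv \<psi> \<xi>) \<le> exp (\<kappa> / d * norm (\<xi> - \<xi>')) * norm (deriv \<psi> \<xi>')"
    by (rule harnack[OF d \<xi>])
  also have "\<dots> \<le> exp (\<kappa> * r / d) * norm (deriv \<psi> \<xi>')"
    using r d kappa_pos by (intro mult_right_mono) (auto simp: divide_right_mono)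
  finally have "norm (deriv \<psi> \<xi>) powr s \<le> (exp (\<kappa> * r / d) * norm (deriv \<psi> \<xi>')) powr s"
    using s by (intro powr_mono2) auto
  also have "\<dots> = exp (\<kappa> * r / d * s) * norm (deriv \<psi> \<xi>') powr s"
    by (simp add: powr_mult exp_powr_real)
  finally show ?thesis .
qed

text \<open>Comparison with the line by \<open>harnack\<close> would cost a factor that grows with
  \<open>Re \<xi>\<close>; the maximum principle keeps the same \<open>B\<close> on the whole
  half-plane.\<close>

lemma sum_powr_le_of_line:
  fixes K :: "int set"
  assumes x0: "0 < x0" and s: "0 \<le> s" and K: "finite K"
    and line: "\<And>\<xi>. Re \<xi> = x0 \<Longrightarrow> (\<Sum>k\<in>K. norm (deriv \<psi> (\<xi> + of_int (2 * k) * pi * \<i>)) powr s) \<le> B"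
    and \<xi>: "x0 \<le> Re \<xi>"
  shows "(\<Sum>k\<in>K. norm (deriv \<psi> (\<xi> + of_int (2 * k) * pi * \<i>)) powr s) \<le> B"
proof -
  obtain L where L: "L holomorphic_on right_half_plane"
    "\<And>\<xi>. 0 < Re \<xi> \<Longrightarrow> exp (L \<xi>) = deriv \<psi> \<xi>"
    using deriv_log by metis
  define c where "c k = of_int (2 * k) * pi * \<i>" for k :: int
  define G where "G z = exp (of_real s * L z)" for z
  have norm_G: "norm (G z) = norm (deriv \<psi> z) powr s" if "0 < Re z" for z
    using L(2)[OF that, symmetric] by (simp add: G_def powr_def)
  define e where "e k = cnj (sgn (G (\<xi> + c k)))" for k
  have G_nz: "G z \<noteq> 0" for z
    by (simp add: G_def)
  have norm_e: "norm (e k) = 1" for k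
    by (simp add: e_def norm_sgn G_nz)
  \<comment> \<open>The unimodular weights make the sum of moduli at \<open>\<xi>\<close> the value of one bounded holomorphic function.\<close>
  define S where "S z = (\<Sum>k\<in>K. e k * G (z + c k))" for z
  have Re_c: "Re (c k) = 0" for k
    by (simp add: c_def)
  have S_le: "norm (S z) \<le> (\<Sum>k\<in>K. norm (deriv \<psi> (z + c k)) powr s)" if "0 < Re z" for z
    unfolding S_def using that
    by (intro sum_norm_le) (simp add: norm_mult norm_e, subst norm_G, auto simp: Re_c)
  have G_holo: "G holomorphic_on right_half_plane"
    unfolding G_def by (intro holomorphic_intros L)
  have "(\<lambda>z. G (z + c k)) holomorphic_on right_half_plane" for k
  proof -
    have "(G \<circ> (\<lambda>z. z + c k)) holomorphic_on right_half_plane"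
      by (intro holomorphic_on_compose_gen[OF _ G_holo] holomorphic_intros)
         (auto simp: right_half_plane_def c_def)
    then show ?thesis
      by (simp add: o_def)
  qed
  then have S_holo: "S holomorphic_on right_half_plane"
    unfolding S_def by (intro holomorphic_intros)
  have "norm (S \<xi>) \<le> B"
  proof (rule half_plane_bounded_maximum[OF S_holo x0 _ _ \<xi>])
    fix z assume z: "x0 \<le> Re z"
    have "norm (S z) \<le> (\<Sum>k\<in>K. norm (deriv \<psi> (z + c k)) powr s)"
      using S_le z x0 by simp
    \<comment> \<open>A bound that depends on \<open>K\<close>; only its existence enters
      \<open>half_plane_bounded_maximum\<close>.\<close>
    also have "\<dots> \<le> (\<Sum>k\<in>K. (12 * pi / x0) powr s)"
    proof (intro sum_mono powr_mono2 s norm_ge_zero)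
      fix k
      have "norm (deriv \<psi> (z + c k)) \<le> 12 * pi / Re z"
        using deriv_le[of "z + c k"] z x0 by (simp add: Re_c)
      also have "\<dots> \<le> 12 * pi / x0"
        using z x0 by (simp add: frac_le)
      finally show "norm (deriv \<psi> (z + c k)) \<le> 12 * pi / x0" .
    qed
    finally show "norm (S z) \<le> (\<Sum>k\<in>K. (12 * pi / x0) powr s)" .
  next
    fix z assume "Re z = x0"
    then show "norm (S z) \<le> B"
      using S_le[of z] line[of z] x0 by (simp add: c_def)
  qed
  moreover have "S \<xi> = of_real (\<Sum>k\<in>K. norm (deriv \<psi> (\<xi> + c k)) powr s)"
  proof -
    have "e k * G (\<xi> + c k) = of_real (norm (deriv \<psi> (\<xi> + c k)) powr s)" for k
    proof -
      have "e k * G (\<xi> + c k) = of_real (norm (G (\<xi> + c k)))"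
        using G_nz[of "\<xi> + c k"]
        by (simp add: e_def sgn_div_norm scaleR_conv_of_real complex_norm_square power2_eq_square mult.commute divide_simps)
           (metis complex_norm_square power2_eq_square mult.commute of_real_mult)
      then show ?thesis
        using \<xi> x0 by (simp add: norm_G Re_c)
    qed
    then show ?thesis
      by (simp add: S_def)
  qed
  ultimately show ?thesis
    by (simp add: c_def sum_nonneg del: of_real_sum)
qed

end

section \<open>Mass on a vertical line\<close>

context log_tract
begin

text \<open>A measure rather than an integral: infinite mass is then a legitimate value, and
  splitting the line into intervals or annuli is additivity or subadditivity.\<close>

definition line_mass :: "real \<Rightarrow> real measure" where
  "line_mass s = density lborel (\<lambda>u. ennreal (norm (deriv \<psi> (Complex 1 u)) powr s))"

lemma continuous_on_line: "continuous_on A (\<lambda>u. norm (deriv \<psi> (Complex 1 u)) powr s)"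
proof -
  have "continuous_on A (deriv \<psi> \<circ> (\<lambda>u. Complex 1 u))"
  proof (rule continuous_on_compose)
    show "continuous_on A (Complex 1)"
      unfolding Complex_eq by (intro continuous_intros)
    show "continuous_on (Complex 1 ` A) (deriv \<psi>)"
      by (rule continuous_on_subset[OF holomorphic_on_imp_continuous_on[OF deriv_holo]])
         (auto simp: right_half_plane_def)
  qed
  then show ?thesis
    using deriv_nonzero by (auto intro!: continuous_intros simp: o_def)
qed

lemma measurable_line [measurable]: "(\<lambda>u. norm (deriv \<psi> (Complex 1 u)) powr s) \<in> borel_measurable borel"
  using continuous_on_line by (rule borel_measurable_continuous_onI)

lemma sets_line_mass [simp, measurable_cong]: "sets (line_mass s) = sets borel"
  by (simp add: line_mass_def)

lemma emeasure_line_mass: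
  "A \<in> sets borel \<Longrightarrow>
    emeasure (line_mass s) A = (\<integral>\<^sup>+u. ennreal (norm (deriv \<psi> (Complex 1 u)) powr s) * indicator A u \<partial>lborel)"
  unfolding line_mass_def by (subst emeasure_density) auto

lemma line_mass_le:
  assumes A: "A \<in> sets borel" and le: "\<And>u. u \<in> A \<Longrightarrow> norm (deriv \<psi> (Complex 1 u)) powr s \<le> c"
  shows "emeasure (line_mass s) A \<le> ennreal c * emeasure lborel A"
proof -
  have "emeasure (line_mass s) A \<le> (\<integral>\<^sup>+u. ennreal c * indicator A u \<partial>lborel)"
    unfolding emeasure_line_mass[OF A]
    by (intro nn_integral_mono) (auto simp: indicator_def le intro!: ennreal_leI)
  also have "\<dots> = ennreal c * emeasure lborel A"
    using A by (simp add: nn_integral_cmult_indicator)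
  finally show ?thesis .
qed

lemma line_mass_ge:
  assumes A: "A \<in> sets borel" and le: "\<And>u. u \<in> A \<Longrightarrow> c \<le> norm (deriv \<psi> (Complex 1 u)) powr s"
  shows "ennreal c * emeasure lborel A \<le> emeasure (line_mass s) A"
proof -
  have "ennreal c * emeasure lborel A = (\<integral>\<^sup>+u. ennreal c * indicator A u \<partial>lborel)"
    using A by (simp add: nn_integral_cmult_indicator)
  also have "\<dots> \<le> emeasure (line_mass s) A"
    unfolding emeasure_line_mass[OF A]
    by (intro nn_integral_mono) (auto simp: indicator_def le intro!: ennreal_leI)
  finally show ?thesis .
qed

lemma line_mass_interval_finite:
  assumes "0 \<le> s"
  shows "emeasure (line_mass s) {a..b} < \<infinity>"
proof -
  have "emeasure (line_mass s) {a..b} \<le> ennreal ((12 * pi) powr s) * emeasure lborel {a..b}"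
  proof (rule line_mass_le)
    fix u
    show "norm (deriv \<psi> (Complex 1 u)) powr s \<le> (12 * pi) powr s"
      using deriv_le[of "Complex 1 u"] assms by (intro powr_mono2) auto
  qed simp
  also have "\<dots> < \<infinity>"
    by (cases "a \<le> b") (auto simp: ennreal_mult_less_top)
  finally show ?thesis .
qed

text \<open>The points \<open>y k\<close> are \<open>2 * pi\<close> apart, so the intervals
  \<open>{y k..y k + 1}\<close> are disjoint. On each of them Harnack bounds the term of the sum by
  \<open>C\<close> times the density, since the points compared have distance at most
  \<open>\<bar>x0 - 1\<bar> + 1\<close> and real part at least \<open>d\<close>.\<close>

lemma sum_powr_le_line_mass:
  assumes s: "0 \<le> s" and x0: "0 < x0"
  obtains C where "0 \<le> C" and "\<And>\<xi> K :: int set. Re \<xi> = x0 \<Longrightarrow> finite K \<Longrightarrow>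
    ennreal (\<Sum>k\<in>K. norm (deriv \<psi> (\<xi> + of_int (2 * k) * pi * \<i>)) powr s)
      \<le> ennreal C * emeasure (line_mass s) UNIV"
proof -
  define d where "d = min x0 1"
  define C where "C = exp (\<kappa> * (\<bar>x0 - 1\<bar> + 1) / d * s)"
  have d: "0 < d" "d \<le> x0" "d \<le> 1"
    using x0 by (auto simp: d_def)
  have C: "0 < C"
    by (simp add: C_def)
  have "ennreal (\<Sum>k\<in>K. norm (deriv \<psi> (\<xi> + of_int (2 * k) * pi * \<i>)) powr s)
      \<le> ennreal C * emeasure (line_mass s) UNIV" if \<xi>: "Re \<xi> = x0" and K: "finite K" for \<xi> and K :: "int set"
  proof -
    define y where "y k = Im \<xi> + 2 * pi * of_int k" for k :: int
    have \<xi>_eq: "\<xi> + of_int (2 * k) * pi * \<i> = Complex x0 (y k)" for k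
      using \<xi> by (simp add: y_def complex_eq_iff)
    have "(norm (deriv \<psi> (Complex x0 (y k))) powr s) / C \<le> norm (deriv \<psi> (Complex 1 u)) powr s"
      if "u \<in> {y k..y k + 1}" for u k
    proof -
      have "norm (Complex x0 (y k) - Complex 1 u) \<le> \<bar>x0 - 1\<bar> + 1"
        using that cmod_le[of "Complex x0 (y k) - Complex 1 u"] by auto
      then have "norm (deriv \<psi> (Complex x0 (y k))) powr s \<le> C * norm (deriv \<psi> (Complex 1 u)) powr s"
        unfolding C_def by (intro harnack_powr) (use d s in auto)
      then show ?thesis
        using C by (simp add: pos_divide_le_eq mult.commute)
    qed
    then have *: "ennreal (norm (deriv \<psi> (Complex x0 (y k))) powr s / C) \<le> emeasure (line_mass s) {y k..y k + 1}" for k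
      using line_mass_ge[of "{y k..y k + 1}" "norm (deriv \<psi> (Complex x0 (y k))) powr s / C" s] by simp
    have disj: "disjoint_family_on (\<lambda>k. {y k..y k + 1}) K"
    unfolding disjoint_family_on_def
    proof (intro ballI impI)
      fix k l assume "k \<in> K" "l \<in> K" "k \<noteq> l"
      have aux: "2 * pi * real_of_int a + 1 < 2 * pi * real_of_int b" if "a < b" for a b :: int
      proof -
        have "2 * pi * (real_of_int a + 1) \<le> 2 * pi * real_of_int b"
          using that by (intro mult_left_mono) auto
        then show ?thesis
          using pi_gt3 by (simp add: distrib_left)
      qed
      show "{y k..y k + 1} \<inter> {y l..y l + 1} = {}"
        using \<open>k \<noteq> l\<close> aux[of k l] aux[of l k] by (auto simp: y_def neq_iff)
    qed
    have "ennreal ((\<Sum>k\<in>K. norm (deriv \<psi> (Complex x0 (y k))) powr s) / C)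
        = (\<Sum>k\<in>K. ennreal (norm (deriv \<psi> (Complex x0 (y k))) powr s / C))"
      using C by (subst sum_ennreal) (auto simp: sum_divide_distrib)
    also have "\<dots> \<le> (\<Sum>k\<in>K. emeasure (line_mass s) {y k..y k + 1})"
      by (intro sum_mono *)
    also have "\<dots> = emeasure (line_mass s) (\<Union>k\<in>K. {y k..y k + 1})"
      by (rule sum_emeasure) (use disj K in auto)
    also have "\<dots> \<le> emeasure (line_mass s) UNIV"
      by (intro emeasure_mono) auto
    finally have "ennreal C * ennreal ((\<Sum>k\<in>K. norm (deriv \<psi> (Complex x0 (y k))) powr s) / C)
        \<le> ennreal C * emeasure (line_mass s) UNIV"
      by (intro mult_left_mono) auto
    moreover have "ennreal C * ennreal ((\<Sum>k\<in>K. norm (deriv \<psi> (Complex x0 (y k))) powr s) / C)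
        = ennreal (\<Sum>k\<in>K. norm (deriv \<psi> (Complex x0 (y k))) powr s)"
      using C by (simp add: ennreal_mult' flip: ennreal_mult')
    ultimately show ?thesis
      unfolding \<xi>_eq by simp
  qed
  with C show thesis
    by (intro that[of C]) auto
qed

text \<open>The mass controls the finite sums on the line \<open>Re \<xi> = x0\<close>, and the
  maximum principle spreads this bound to its right.\<close>

lemma sum_powr_bounded:
  assumes s: "0 \<le> s" and x0: "0 < x0" and fin: "emeasure (line_mass s) UNIV < \<infinity>"
  shows "\<exists>B\<ge>0. \<forall>\<xi> K. x0 \<le> Re \<xi> \<longrightarrow> finite (K :: int set) \<longrightarrow>
    (\<Sum>k\<in>K. norm (deriv \<psi> (\<xi> + of_int (2 * k) * pi * \<i>)) powr s) \<le> B"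
proof -
  obtain C where C: "0 \<le> C" "\<And>\<xi> K :: int set. Re \<xi> = x0 \<Longrightarrow> finite K \<Longrightarrow>
    ennreal (\<Sum>k\<in>K. norm (deriv \<psi> (\<xi> + of_int (2 * k) * pi * \<i>)) powr s)
      \<le> ennreal C * emeasure (line_mass s) UNIV"
    using sum_powr_le_line_mass[OF s x0] by blast
  obtain m where m: "0 \<le> m" "emeasure (line_mass s) UNIV = ennreal m"
    using fin by (cases "emeasure (line_mass s) UNIV") auto
  have line: "(\<Sum>k\<in>K. norm (deriv \<psi> (\<xi> + of_int (2 * k) * pi * \<i>)) powr s) \<le> C * m"
    if "Re \<xi> = x0" "finite K" for \<xi> and K :: "int set"
    using C(2)[OF that] C(1) m by (simp flip: ennreal_mult)
  show ?thesis
  proof (intro exI[of _ "C * m"] conjI allI impI)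
    show "0 \<le> C * m" using C m by simp
    show "(\<Sum>k\<in>K. norm (deriv \<psi> (\<xi> + of_int (2 * k) * pi * \<i>)) powr s) \<le> C * m"
      if "x0 \<le> Re \<xi>" "finite K" for \<xi> and K :: "int set"
      by (rule sum_powr_le_of_line[OF x0 s that(2) line that(1)]) (use that in auto)
  qed
qed

text \<open>The converse comparison, from bounded sums at a single point \<xi>: intervals of length
  \<open>2 * pi\<close> starting at the \<open>y k\<close> cover the line, and Harnack bounds the
  density on each by the corresponding term.\<close>

lemma line_mass_finite:
  assumes s: "0 \<le> s" and \<xi>: "0 < Re \<xi>"
    and B: "\<And>K :: int set. finite K \<Longrightarrow>
      (\<Sum>k\<in>K. norm (deriv \<psi> (\<xi> + of_int (2 * k) * pi * \<i>)) powr s) \<le> B"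
  shows "emeasure (line_mass s) UNIV < \<infinity>"
proof -
  define d where "d = min (Re \<xi>) 1"
  define C where "C = exp (\<kappa> * (\<bar>Re \<xi> - 1\<bar> + 2 * pi) / d * s)"
  define y where "y k = Im \<xi> + 2 * pi * of_int k" for k :: int
  define F where "F n = (\<Union>k\<in>{- int n..int n}. {y k..y k + 2 * pi})" for n :: nat
  have d: "0 < d" "d \<le> Re \<xi>" "d \<le> 1"
    using \<xi> by (auto simp: d_def)
  have C: "0 < C"
    by (simp add: C_def)
  define a where "a k = norm (deriv \<psi> (\<xi> + of_int (2 * k) * pi * \<i>)) powr s" for k
  have \<xi>_eq: "\<xi> + of_int (2 * k) * pi * \<i> = Complex (Re \<xi>) (y k)" for k
    by (simp add: y_def complex_eq_iff)
  have *: "emeasure (line_mass s) {y k..y k + 2 * pi} \<le> ennreal (C * a k * (2 * pi))" for k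
  proof -
    have "emeasure (line_mass s) {y k..y k + 2 * pi} \<le> ennreal (C * a k) * emeasure lborel {y k..y k + 2 * pi}"
    proof (rule line_mass_le)
      fix u assume "u \<in> {y k..y k + 2 * pi}"
      then have "norm (Complex 1 u - Complex (Re \<xi>) (y k)) \<le> \<bar>Re \<xi> - 1\<bar> + 2 * pi"
        using cmod_le[of "Complex 1 u - Complex (Re \<xi>) (y k)"] by auto
      then show "norm (deriv \<psi> (Complex 1 u)) powr s \<le> C * a k"
        unfolding C_def a_def \<xi>_eq by (intro harnack_powr) (use d s in auto)
    qed simp
    then show ?thesis
      using C by (simp add: a_def flip: ennreal_mult)
  qed
  have F_le: "emeasure (line_mass s) (F n) \<le> ennreal (C * B * (2 * pi))" for n
  proof -
    have "emeasure (line_mass s) (F n) \<le> (\<Sum>k\<in>{- int n..int n}. emeasure (line_mass s) {y k..y k + 2 * pi})"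
      unfolding F_def by (rule emeasure_subadditive_finite) auto
    also have "\<dots> \<le> (\<Sum>k\<in>{- int n..int n}. ennreal (C * a k * (2 * pi)))"
      by (intro sum_mono *)
    also have "\<dots> = ennreal (\<Sum>k\<in>{- int n..int n}. C * a k * (2 * pi))"
      using C by (intro sum_ennreal) (simp add: a_def)
    also have "\<dots> = ennreal (C * (\<Sum>k\<in>{- int n..int n}. a k) * (2 * pi))"
      by (simp add: sum_distrib_left sum_distrib_right)
    also have "\<dots> \<le> ennreal (C * B * (2 * pi))"
      using B[of "{- int n..int n}"] C
      by (intro ennreal_leI mult_right_mono mult_left_mono) (auto simp: a_def)
    finally show ?thesis .
  qed
  have "(\<Union>n. F n) = UNIV"
  proof -
    have "u \<in> (\<Union>n. F n)" for u
    proof -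
      define k where "k = \<lfloor>(u - Im \<xi>) / (2 * pi)\<rfloor>"
      have "of_int k \<le> (u - Im \<xi>) / (2 * pi)" "(u - Im \<xi>) / (2 * pi) \<le> of_int k + 1"
        unfolding k_def by linarith+
      then have "of_int k * (2 * pi) \<le> u - Im \<xi>" "u - Im \<xi> \<le> (of_int k + 1) * (2 * pi)"
        by (simp_all add: pos_le_divide_eq pos_divide_le_eq)
      then have "u \<in> {y k..y k + 2 * pi}"
        by (auto simp: y_def algebra_simps)
      moreover have "k \<in> {- int (nat \<bar>k\<bar>)..int (nat \<bar>k\<bar>)}"
        by auto
      ultimately show ?thesis
        unfolding F_def by blast
    qed
    then show ?thesis by blast
  qed
  moreover have "(SUP n. emeasure (line_mass s) (F n)) = emeasure (line_mass s) (\<Union>n. F n)"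
  proof (rule SUP_emeasure_incseq)
    show "range F \<subseteq> sets (line_mass s)"
      by (auto simp: F_def)
    have "F n \<subseteq> F m" if "n \<le> m" for n m
      unfolding F_def by (rule UN_mono) (use that in auto)
    then show "incseq F"
      by (auto simp: incseq_def)
  qed
  ultimately have "emeasure (line_mass s) UNIV \<le> ennreal (C * B * (2 * pi))"
    using SUP_least[of UNIV "\<lambda>n. emeasure (line_mass s) (F n)"] F_le by simp
  then show ?thesis
    using le_less_trans ennreal_less_top by (metis infinity_ennreal_def)
qed

text \<open>Harnack along the line \<open>Re = 1\<close> would only give an exponential bound.
  Instead the chain of comparisons runs from 1 to \<open>2 ^ n\<close>, across to
  \<open>2 ^ n + \<i> u\<close>, and back to \<open>1 + \<i> u\<close>. Each doubling of the real
  part costs a factor \<open>exp \<kappa>\<close>, and so does the crossing once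
  \<open>2 ^ n\<close> exceeds \<open>\<bar>u\<bar>\<close>; with \<open>n\<close> about
  \<open>log 2 T\<close> the total loss is a power of \<open>T\<close>.\<close>

lemma deriv_ge_power:
  obtains c m where "0 < c" and "0 \<le> m"
    and "\<And>T u. 1 \<le> T \<Longrightarrow> \<bar>u\<bar> \<le> 2 * T \<Longrightarrow> c * T powr (- m) \<le> norm (deriv \<psi> (Complex 1 u))"
proof -
  have step: "norm (deriv \<psi> (Complex (2 ^ n) u)) \<le> exp (\<kappa> * n) * norm (deriv \<psi> (Complex 1 u))"
    "norm (deriv \<psi> (Complex 1 u)) \<le> exp (\<kappa> * n) * norm (deriv \<psi> (Complex (2 ^ n) u))" for n u
  proof (induction n)
    case (Suc n)
    have dist: "norm (Complex (2 ^ Suc n) u - Complex (2 ^ n) u) = 2 ^ n"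
      "norm (Complex (2 ^ n) u - Complex (2 ^ Suc n) u) = 2 ^ n"
      by (auto simp: cmod_def)
    have one: "norm (deriv \<psi> (Complex (2 ^ Suc n) u)) \<le> exp \<kappa> * norm (deriv \<psi> (Complex (2 ^ n) u))"
      "norm (deriv \<psi> (Complex (2 ^ n) u)) \<le> exp \<kappa> * norm (deriv \<psi> (Complex (2 ^ Suc n) u))"
      using harnack[of "2 ^ n" "Complex (2 ^ Suc n) u" "Complex (2 ^ n) u"]
        harnack[of "2 ^ n" "Complex (2 ^ n) u" "Complex (2 ^ Suc n) u"] unfolding dist by auto
    {
      case 1
      have "norm (deriv \<psi> (Complex (2 ^ Suc n) u)) \<le> exp \<kappa> * (exp (\<kappa> * n) * norm (deriv \<psi> (Complex 1 u)))"
        using one(1) Suc.IH(1) by (meson order_trans mult_left_mono exp_ge_zero)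
      then show ?case
        by (simp add: exp_add algebra_simps)
    next
      case 2
      have "norm (deriv \<psi> (Complex 1 u)) \<le> exp (\<kappa> * n) * (exp \<kappa> * norm (deriv \<psi> (Complex (2 ^ Suc n) u)))"
        using one(2) Suc.IH(2) by (meson order_trans mult_left_mono exp_ge_zero)
      then show ?case
        by (simp add: exp_add algebra_simps)
    }
  qed auto
  \<comment> \<open>Both constants are read off from the total loss \<open>exp (\<kappa> * (2 * log
    2 T + 5)) = T powr m * exp (5 * \<kappa>)\<close>.\<close>
  define c where "c = norm (deriv \<psi> 1) * exp (- (5 * \<kappa>))"
  define m where "m = 2 * \<kappa> / ln 2"
  show thesis
  proof (rule that)
    show "0 < c"
      using deriv_nonzero[of 1] by (simp add: c_def)
    show "0 \<le> m"
      using kappa_pos by (simp add: m_def)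
    fix T u :: real assume T: "1 \<le> T" and u: "\<bar>u\<bar> \<le> 2 * T"
    \<comment> \<open>Large enough for \<open>2 * T \<le> 2 ^ n\<close>, and at most
      \<open>log 2 T + 2\<close>, whence \<open>2 * n + 1 \<le> 2 * log 2 T + 5\<close>.\<close>
    define n where "n = nat \<lceil>log 2 (2 * T)\<rceil>"
    have "0 \<le> log 2 (2 * T)"
      using T by simp
    then have n: "log 2 (2 * T) \<le> n" "n \<le> log 2 (2 * T) + 1"
      unfolding n_def by linarith+
    have "2 * T = 2 powr (log 2 (2 * T))"
      using T by simp
    also have "\<dots> \<le> 2 powr n"
      using n by simp
    finally have "2 * T \<le> 2 ^ n"
      by (simp add: powr_realpow)
    have dist: "norm (Complex (2 ^ n) 0 - Complex (2 ^ n) u) = \<bar>u\<bar>"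
      by (simp add: cmod_def)
    have "norm (deriv \<psi> (Complex (2 ^ n) 0)) \<le> exp (\<kappa> / 2 ^ n * \<bar>u\<bar>) * norm (deriv \<psi> (Complex (2 ^ n) u))"
      using harnack[of "2 ^ n" "Complex (2 ^ n) 0" "Complex (2 ^ n) u"] by (simp add: dist)
    also have "\<dots> \<le> exp \<kappa> * norm (deriv \<psi> (Complex (2 ^ n) u))"
    proof -
      have "\<kappa> * \<bar>u\<bar> \<le> \<kappa> * 2 ^ n"
        using kappa_pos u \<open>2 * T \<le> 2 ^ n\<close> by (intro mult_left_mono) auto
      then show ?thesis
        by (intro mult_right_mono) (auto simp: divide_le_eq)
    qed
    finally have across: "norm (deriv \<psi> (Complex (2 ^ n) 0)) \<le> exp \<kappa> * norm (deriv \<psi> (Complex (2 ^ n) u))" .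
    have "norm (deriv \<psi> (Complex 1 0)) \<le> exp (\<kappa> * n) * norm (deriv \<psi> (Complex (2 ^ n) 0))"
      by (rule step)
    also have "\<dots> \<le> exp (\<kappa> * n) * (exp \<kappa> * norm (deriv \<psi> (Complex (2 ^ n) u)))"
      using across by (rule mult_left_mono) simp
    also have "\<dots> \<le> exp (\<kappa> * n) * (exp \<kappa> * (exp (\<kappa> * n) * norm (deriv \<psi> (Complex 1 u))))"
      using step(1)[of n u] by (intro mult_left_mono) auto
    also have "\<dots> = exp (\<kappa> * (2 * n + 1)) * norm (deriv \<psi> (Complex 1 u))"
      by (simp add: exp_add algebra_simps flip: exp_add)
    also have "\<dots> \<le> exp (\<kappa> * (2 * log 2 T + 5)) * norm (deriv \<psi> (Complex 1 u))"
      using n T kappa_pos by (intro mult_right_mono) (auto simp: log_mult)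
    also have "exp (\<kappa> * (2 * log 2 T + 5)) = T powr m * exp (5 * \<kappa>)"
      using T by (simp add: m_def powr_def log_def exp_add [symmetric] algebra_simps)
    finally have "norm (deriv \<psi> 1) \<le> T powr m * exp (5 * \<kappa>) * norm (deriv \<psi> (Complex 1 u))"
      by (simp add: complex_of_real_def one_complex.code)
    then have "norm (deriv \<psi> 1) * (exp (- (5 * \<kappa>)) * T powr (- m))
        \<le> (T powr m * exp (5 * \<kappa>) * norm (deriv \<psi> (Complex 1 u))) * (exp (- (5 * \<kappa>)) * T powr (- m))"
      by (intro mult_right_mono) auto
    also have "\<dots> = norm (deriv \<psi> (Complex 1 u))"
      using T by (simp add: powr_minus exp_minus field_simps)
    finally show "c * T powr (- m) \<le> norm (deriv \<psi> (Complex 1 u))"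
      by (simp add: c_def mult.assoc)
  qed
qed

end

section \<open>The integral means spectrum of a tract\<close>

locale spectral_tract = log_tract \<psi> for \<psi> +
  fixes \<Omega> :: "nat \<Rightarrow> complex set" and \<tau> :: "nat \<Rightarrow> complex \<Rightarrow> complex" and j :: nat and M T0 :: real
  assumes exp_eq: "\<And>\<xi>. 0 < Re \<xi> \<Longrightarrow> exp (\<psi> \<xi>) = phi_map \<Omega> \<tau> j \<xi>"
    and comparable: "\<And>T \<xi> \<xi>'. T0 \<le> T \<Longrightarrow> \<xi> \<in> Qsq T - Qsq (T / 8) \<Longrightarrow> \<xi>' \<in> Qsq T - Qsq (T / 8) \<Longrightarrow>
      norm (phi_map \<Omega> \<tau> j \<xi>) \<le> M * norm (phi_map \<Omega> \<tau> j \<xi>')"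
begin

section \<open>Derivatives of the rescaled inverse branches\<close>

definition rescaled_deriv :: "real \<Rightarrow> real \<Rightarrow> real" where
  "rescaled_deriv T y = norm (deriv (rescaled_phi \<Omega> \<tau> j T) (Complex (1 / T) y))"

definition base_set :: "real set" where "base_set = {-2..-1} \<union> {1..2}"

lemma base_set_iff: "y \<in> base_set \<longleftrightarrow> 1 \<le> \<bar>y\<bar> \<and> \<bar>y\<bar> \<le> 2"
  by (auto simp: base_set_def)

text \<open>Multiplication by \<open>T\<close> takes \<open>1 / T + \<i> y\<close> to
  \<open>1 + \<i> T y\<close>, so the spectral integrals for all \<open>T\<close> live on the one
  line \<open>Re = 1\<close>. The formula is the chain rule for
  \<open>exp (\<psi> (T * \<xi>))\<close> divided by a constant.\<close>

lemma rescaled_deriv_eq: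
  assumes T: "0 < T"
  shows "rescaled_deriv T y = T * norm (deriv \<psi> (Complex 1 (T * y))) *
    (norm (phi_map \<Omega> \<tau> j (Complex 1 (T * y))) / norm (phi_map \<Omega> \<tau> j (of_real T)))"
proof -
  let ?c = "of_real (norm (phi_map \<Omega> \<tau> j (of_real T))) :: complex"
  have scale: "of_real T * Complex (1 / T) y = Complex 1 (T * y)"
    using T by (simp add: complex_eq_iff)
  have "(\<psi> has_field_derivative deriv \<psi> (Complex 1 (T * y))) (at (of_real T * Complex (1 / T) y))"
    unfolding scale
    by (rule holomorphic_derivI[OF holo open_right_half_plane]) (simp add: right_half_plane_def)
  then have "((\<lambda>\<xi>. \<psi> (of_real T * \<xi>)) has_field_derivative deriv \<psi> (Complex 1 (T * y)) * of_real T)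
      (at (Complex (1 / T) y))"
    by (rule DERIV_chain2) (auto intro!: derivative_eq_intros)
  then have "((\<lambda>\<xi>. exp (\<psi> (of_real T * \<xi>)) / ?c) has_field_derivative
      exp (\<psi> (of_real T * Complex (1 / T) y)) * (deriv \<psi> (Complex 1 (T * y)) * of_real T) / ?c) (at (Complex (1 / T) y))"
    by (intro derivative_intros DERIV_cdivide) auto
  then have "(rescaled_phi \<Omega> \<tau> j T has_field_derivative
      exp (\<psi> (Complex 1 (T * y))) * (deriv \<psi> (Complex 1 (T * y)) * of_real T) / ?c) (at (Complex (1 / T) y))"
    unfolding scale
    by (rule has_field_derivative_transform_within_open[OF _ open_right_half_plane])
       (use T in \<open>auto simp: right_half_plane_def rescaled_phi_def exp_eq\<close>)
  then show ?thesis
    using T exp_eq[of "Complex 1 (T * y)"]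
    by (simp add: rescaled_deriv_def DERIV_imp_deriv norm_mult norm_divide)
qed

text \<open>For large \<open>T\<close> both \<open>1 + \<i> T y\<close> and \<open>T\<close> itself
  lie in \<open>Qsq T - Qsq (T / 8)\<close>: the first leaves the small box by its imaginary part,
  the second by its real part. The quotient of the moduli of \<open>phi_map\<close> in
  \<open>rescaled_deriv_eq\<close> is therefore bounded above and below.\<close>

lemma rescaled_deriv_bounds:
  obtains C T1 where "1 \<le> C" and "1 \<le> T1" and
    "\<And>T y. T1 \<le> T \<Longrightarrow> y \<in> base_set \<Longrightarrow> rescaled_deriv T y \<le> C * T * norm (deriv \<psi> (Complex 1 (T * y)))"
    "\<And>T y. T1 \<le> T \<Longrightarrow> y \<in> base_set \<Longrightarrow> T * norm (deriv \<psi> (Complex 1 (T * y))) \<le> C * rescaled_deriv T y"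
proof
  \<comment> \<open>\<open>T \<ge> 1\<close> places the abscissa 1 inside \<open>Qsq T\<close>, and
    the maximum with 1 gives a positive constant whatever the sign of \<open>M\<close>.\<close>
  let ?C = "max M 1" and ?T1 = "max T0 1"
  fix T y assume T: "?T1 \<le> T" and y: "y \<in> base_set"
  let ?\<phi> = "phi_map \<Omega> \<tau> j" and ?z = "Complex 1 (T * y)"
  have "\<bar>T * y\<bar> = T * \<bar>y\<bar>"
    using T by (simp add: abs_mult)
  moreover have "T * 1 \<le> T * \<bar>y\<bar>" "T * \<bar>y\<bar> \<le> T * 2"
    using T y by (auto simp: base_set_iff)
  ultimately have z: "?z \<in> Qsq T - Qsq (T / 8)" and t: "of_real T \<in> Qsq T - Qsq (T / 8)"
    using T by (auto simp: Qsq_def)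
  have nz: "?\<phi> \<xi> \<noteq> 0" if "0 < Re \<xi>" for \<xi>
    using exp_eq[OF that] by (metis exp_not_eq_zero)
  have pos: "0 < norm (?\<phi> ?z)" "0 < norm (?\<phi> (of_real T))"
    using T nz[of ?z] nz[of "of_real T"] by auto
  have "norm (?\<phi> ?z) \<le> M * norm (?\<phi> (of_real T))" "norm (?\<phi> (of_real T)) \<le> M * norm (?\<phi> ?z)"
    using comparable[OF _ z t] comparable[OF _ t z] T by auto
  moreover have "M * norm (?\<phi> (of_real T)) \<le> ?C * norm (?\<phi> (of_real T))" "M * norm (?\<phi> ?z) \<le> ?C * norm (?\<phi> ?z)"
    by (auto intro!: mult_right_mono)
  ultimately have "norm (?\<phi> ?z) \<le> ?C * norm (?\<phi> (of_real T))" "norm (?\<phi> (of_real T)) \<le> ?C * norm (?\<phi> ?z)"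
    by linarith+
  then have "norm (?\<phi> ?z) / norm (?\<phi> (of_real T)) \<le> ?C" "1 \<le> ?C * (norm (?\<phi> ?z) / norm (?\<phi> (of_real T)))"
    using pos by (simp_all add: pos_divide_le_eq pos_le_divide_eq del: zero_less_norm_iff)
  then have "T * norm (deriv \<psi> ?z) * (norm (?\<phi> ?z) / norm (?\<phi> (of_real T))) \<le> T * norm (deriv \<psi> ?z) * ?C"
    "T * norm (deriv \<psi> ?z) * 1 \<le> T * norm (deriv \<psi> ?z) * (?C * (norm (?\<phi> ?z) / norm (?\<phi> (of_real T))))"
    using T by (intro mult_left_mono; simp)+
  then show "rescaled_deriv T y \<le> ?C * T * norm (deriv \<psi> ?z)"
    "T * norm (deriv \<psi> ?z) \<le> ?C * rescaled_deriv T y"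
    using T by (simp_all add: rescaled_deriv_eq mult_ac)
qed auto

text \<open>Needed to compare different exponents: \<open>ln (rescaled_deriv T y) / ln T\<close>
  stays bounded. The upper bound comes from \<open>deriv_le\<close>, the lower one from
  \<open>deriv_ge_power\<close>.\<close>

lemma rescaled_deriv_power_bounds:
  obtains K T1 where "0 \<le> K" and "2 \<le> T1" and
    "\<And>T y. T1 \<le> T \<Longrightarrow> y \<in> base_set \<Longrightarrow> T powr (- K) \<le> rescaled_deriv T y \<and> rescaled_deriv T y \<le> T powr K"
proof -
  obtain C T1 where C: "1 \<le> C" "1 \<le> T1"
    and up: "\<And>T y. T1 \<le> T \<Longrightarrow> y \<in> base_set \<Longrightarrow> rescaled_deriv T y \<le> C * T * norm (deriv \<psi> (Complex 1 (T * y)))"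
    and lo: "\<And>T y. T1 \<le> T \<Longrightarrow> y \<in> base_set \<Longrightarrow> T * norm (deriv \<psi> (Complex 1 (T * y))) \<le> C * rescaled_deriv T y"
    using rescaled_deriv_bounds by blast
  obtain c m where c: "0 < c" "0 \<le> m"
    and lower: "\<And>T u. 1 \<le> T \<Longrightarrow> \<bar>u\<bar> \<le> 2 * T \<Longrightarrow> c * T powr (- m) \<le> norm (deriv \<psi> (Complex 1 u))"
    using deriv_ge_power by metis
  define K where "K = max 2 m"
  \<comment> \<open>Beyond \<open>T2\<close> one factor \<open>T\<close> absorbs the constants:
    \<open>C * (12 * pi) \<le> T\<close> in the upper bound and \<open>C \<le> c * T\<close> in the
    lower one.\<close>
  define T2 where "T2 = Max {T1, 2, C * (12 * pi), C / c}"
  have T2: "T1 \<le> T2" "2 \<le> T2" "C * (12 * pi) \<le> T2" "C / c \<le> T2"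
    by (auto simp: T2_def)
  show thesis
  proof (rule that[of K T2])
    fix T y assume T: "T2 \<le> T" and y: "y \<in> base_set"
    have T': "T1 \<le> T" "2 \<le> T" "C * (12 * pi) \<le> T" "C / c \<le> T"
      using T T2 by auto
    have "rescaled_deriv T y \<le> C * T * norm (deriv \<psi> (Complex 1 (T * y)))"
      by (rule up[OF T'(1) y])
    also have "\<dots> \<le> C * T * (12 * pi)"
      using deriv_le[of "Complex 1 (T * y)"] C T' by (intro mult_left_mono) auto
    also have "\<dots> \<le> T * T"
      using T'(2) mult_left_mono[OF T'(3), of T] by (simp add: mult_ac)
    also have "\<dots> = T powr 2"
      using T' by (simp add: power2_eq_square)
    also have "\<dots> \<le> T powr K"
      using T' by (intro powr_mono) (auto simp: K_def)
    finally have 1: "rescaled_deriv T y \<le> T powr K" .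
    have "\<bar>T * y\<bar> \<le> 2 * T"
      using T'(2) y by (auto simp: abs_mult base_set_iff)
    then have "c * T powr (- m) \<le> norm (deriv \<psi> (Complex 1 (T * y)))"
      by (intro lower) (use T' in auto)
    then have "T * (c * T powr (- m)) \<le> C * rescaled_deriv T y"
      using lo[OF T'(1) y] mult_left_mono[of "c * T powr (- m)" "norm (deriv \<psi> (Complex 1 (T * y)))" T] T' by linarith
    moreover have "C * T powr (- m) \<le> T * (c * T powr (- m))"
      using T'(4) c mult_right_mono[of C "T * c" "T powr (- m)"] by (simp add: pos_divide_le_eq mult_ac)
    ultimately have "C * T powr (- m) \<le> C * rescaled_deriv T y"
      by linarith
    then have "T powr (- m) \<le> rescaled_deriv T y"
      using C by simp
    moreover have "T powr (- K) \<le> T powr (- m)"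
      using T' by (intro powr_mono) (auto simp: K_def)
    ultimately show "T powr (- K) \<le> rescaled_deriv T y \<and> rescaled_deriv T y \<le> T powr K"
      using 1 by simp
  qed (use T2 in \<open>auto simp: K_def\<close>)
qed

lemma continuous_on_rescaled_deriv:
  assumes T: "0 < T"
  shows "continuous_on A (\<lambda>y. rescaled_deriv T y powr s)"
proof -
  have nz: "phi_map \<Omega> \<tau> j \<xi> \<noteq> 0" if "0 < Re \<xi>" for \<xi>
    using exp_eq[OF that] by (metis exp_not_eq_zero)
  have vert: "continuous_on A (\<lambda>y. Complex 1 (T * y))"
    unfolding Complex_eq by (intro continuous_intros)
  have img: "(\<lambda>y. Complex 1 (T * y)) ` A \<subseteq> right_half_plane"
    by (auto simp: right_half_plane_def)
  have "continuous_on A (deriv \<psi> \<circ> (\<lambda>y. Complex 1 (T * y)))" "continuous_on A (\<psi> \<circ> (\<lambda>y. Complex 1 (T * y)))"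
    by (intro continuous_on_compose vert continuous_on_subset[OF holomorphic_on_imp_continuous_on img] deriv_holo holo)+
  then have "continuous_on A (\<lambda>y. T * norm (deriv \<psi> (Complex 1 (T * y))) *
      (norm (exp (\<psi> (Complex 1 (T * y)))) / norm (phi_map \<Omega> \<tau> j (of_real T))))"
    using T nz[of "of_real T"] by (auto intro!: continuous_intros simp: o_def)
  then have "continuous_on A (rescaled_deriv T)"
    using T by (simp add: rescaled_deriv_eq[OF T, abs_def] exp_eq)
  moreover have "rescaled_deriv T y \<noteq> 0" for y
    using T nz[of "of_real T"] nz[of "Complex 1 (T * y)"] deriv_nonzero[of "Complex 1 (T * y)"]
    by (simp add: rescaled_deriv_eq)
  ultimately show ?thesis
    by (intro continuous_on_powr continuous_on_const) auto
qed

lemma integrable_on_base_set: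
  fixes h :: "real \<Rightarrow> real"
  assumes "continuous_on UNIV h"
  shows "h integrable_on base_set"
proof -
  have "h integrable_on {a..b}" for a b
    by (rule integrable_continuous_real[OF continuous_on_subset[OF assms]]) simp
  moreover have "{-2..-1} \<inter> {1..2} = ({} :: real set)"
    by auto
  ultimately show ?thesis
    unfolding base_set_def by (intro integrable_Un) auto
qed

lemma integral_base_set_const: "integral base_set (\<lambda>y. c) = 2 * (c :: real)"
proof -
  have "((\<lambda>y. c) has_integral (c + c)) base_set"
    unfolding base_set_def
  proof (rule has_integral_Un)
    show "((\<lambda>y. c) has_integral c) {-2..-1::real}" "((\<lambda>y. c) has_integral c) {1..2::real}"
      using has_integral_const_real[of c "-2" "-1"] has_integral_const_real[of c 1 2] by auto
    have "{-2..-1} \<inter> {1..2} = ({} :: real set)"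
      by auto
    then show "negligible ({-2..-1} \<inter> {1..2::real})"
      by simp
  qed
  then show ?thesis
    by (simp add: integral_unique)
qed

definition spectral_int :: "real \<Rightarrow> real \<Rightarrow> real" where
  "spectral_int s T = integral base_set (\<lambda>y. rescaled_deriv T y powr s)"

lemma beta_int_eq: "beta_int (rescaled_phi \<Omega> \<tau> j T) (1 / T) s = ln (spectral_int s T) / ln T"
  by (simp add: beta_int_def spectral_int_def rescaled_deriv_def base_set_def)

text \<open>The substitution \<open>u = T * y\<close>, together with the passage from the gauge
  integral in \<open>beta_int\<close> to the Lebesgue integral behind
  \<open>line_mass\<close>.\<close>

lemma line_mass_annulus:
  assumes T: "0 < T"
  shows "emeasure (line_mass s) {u. T \<le> \<bar>u\<bar> \<and> \<bar>u\<bar> \<le> 2 * T}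
    = ennreal (T * integral base_set (\<lambda>y. norm (deriv \<psi> (Complex 1 (T * y))) powr s))"
proof -
  let ?A = "{u. T \<le> \<bar>u\<bar> \<and> \<bar>u\<bar> \<le> 2 * T}"
  let ?h = "\<lambda>y. norm (deriv \<psi> (Complex 1 (T * y))) powr s"
  have A: "?A \<in> sets borel"
    by measurable
  have base_set_borel: "base_set \<in> sets borel"
    by (simp add: base_set_def)
  have "continuous_on UNIV ((\<lambda>u. norm (deriv \<psi> (Complex 1 u)) powr s) \<circ> (\<lambda>y. T * y))"
    by (intro continuous_on_compose continuous_on_line continuous_intros)
  then have cont: "continuous_on UNIV ?h"
    by (simp add: o_def)
  have h_meas: "?h \<in> borel_measurable borel"
    by (rule borel_measurable_continuous_onI[OF cont])
  have ind: "indicator ?A (T * y) = (indicator base_set y :: ennreal)" for y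
  proof -
    have "\<bar>T * y\<bar> = T * \<bar>y\<bar>"
      using T by (simp add: abs_mult)
    then show ?thesis
      using T by (simp add: indicator_def base_set_iff)
  qed
  have "(?h has_integral integral base_set ?h) base_set"
    by (rule integrable_integral[OF integrable_on_base_set[OF cont]])
  then have "((\<lambda>y. if y \<in> base_set then ?h y else 0) has_integral integral base_set ?h) UNIV"
    by (simp only: has_integral_restrict_UNIV)
  then have "((\<lambda>y. indicator base_set y * ?h y) has_integral integral base_set ?h) UNIV"
    by (rule has_integral_eq[rotated]) (auto simp: indicator_def)
  then have 1: "(\<integral>\<^sup>+y. ennreal (indicator base_set y * ?h y) \<partial>lborel) = ennreal (integral base_set ?h)"
    by (intro nn_integral_has_integral_lborel borel_measurable_times h_meas borel_measurable_indicator base_set_borel) auto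
  have "emeasure (line_mass s) ?A
      = (\<integral>\<^sup>+u. ennreal (norm (deriv \<psi> (Complex 1 u)) powr s) * indicator ?A u \<partial>lborel)"
    by (rule emeasure_line_mass[OF A])
  also have "\<dots> = ennreal \<bar>T\<bar> * (\<integral>\<^sup>+y. ennreal (norm (deriv \<psi> (Complex 1 (0 + T * y))) powr s) * indicator ?A (0 + T * y) \<partial>lborel)"
    by (rule nn_integral_real_affine) (use T A in auto)
  also have "\<dots> = ennreal T * (\<integral>\<^sup>+y. ennreal (indicator base_set y * ?h y) \<partial>lborel)"
  proof -
    have "ennreal (norm (deriv \<psi> (Complex 1 (0 + T * y))) powr s) * indicator ?A (0 + T * y)
        = ennreal (indicator base_set y * ?h y)" for y
      by (simp only: add_0_left ind) (simp add: indicator_def)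
    then show ?thesis
      using T by simp
  qed
  also have "\<dots> = ennreal (T * integral base_set ?h)"
    unfolding 1 using T by (simp add: ennreal_mult')
  finally show ?thesis .
qed

section \<open>The spectrum as a function of the exponent, and its relation to the line mass\<close>

lemma spectral_int_mono:
  assumes T: "0 < T" and c: "0 \<le> c"
    and le: "\<And>y. y \<in> base_set \<Longrightarrow> rescaled_deriv T y powr s \<le> c * rescaled_deriv T y powr s'"
  shows "spectral_int s T \<le> c * spectral_int s' T"
proof -
  have "spectral_int s T \<le> integral base_set (\<lambda>y. c * rescaled_deriv T y powr s')"
    unfolding spectral_int_def using le
    by (intro integral_le integrable_on_base_set continuous_intros continuous_on_rescaled_deriv T) auto
  then show ?thesis
    by (simp add: spectral_int_def)
qed

lemma spectral_int_zero: "0 < T \<Longrightarrow> spectral_int 0 T = 2"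
proof -
  assume T: "0 < T"
  \<comment> \<open>Since \<open>0 powr 0 = 0\<close>, the integrand with exponent 0 equals 1 only
    where the derivative does not vanish.\<close>
  have "rescaled_deriv T y \<noteq> 0" for y
    using T exp_not_eq_zero exp_eq[of "of_real T"] exp_eq[of "Complex 1 (T * y)"] deriv_nonzero[of "Complex 1 (T * y)"]
    by (auto simp: rescaled_deriv_eq)
  then show ?thesis
    by (simp add: spectral_int_def integral_base_set_const)
qed

text \<open>As the rescaled derivative lies between \<open>T powr (- K)\<close> and
  \<open>T powr K\<close>, replacing the exponent \<open>s'\<close> by \<open>s\<close> changes the
  integrand by at most a factor \<open>T powr (K * \<bar>s - s'\<bar>)\<close>. After division by
  \<open>ln T\<close> this is a Lipschitz bound uniform in \<open>T\<close>.\<close>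

lemma spectral_int_comparison:
  obtains K T1 where "0 \<le> K" and "2 \<le> T1" and
    "\<And>T s. T1 \<le> T \<Longrightarrow> 0 \<le> s \<Longrightarrow> 0 < spectral_int s T" and
    "\<And>T s s'. T1 \<le> T \<Longrightarrow> 0 \<le> s \<Longrightarrow> 0 \<le> s' \<Longrightarrow>
      ln (spectral_int s T) / ln T \<le> ln (spectral_int s' T) / ln T + K * \<bar>s - s'\<bar>"
proof -
  obtain K T1 where K: "0 \<le> K" "2 \<le> T1" and
    bd: "\<And>T y. T1 \<le> T \<Longrightarrow> y \<in> base_set \<Longrightarrow> T powr (- K) \<le> rescaled_deriv T y \<and> rescaled_deriv T y \<le> T powr K"
    using rescaled_deriv_power_bounds by metis
  have cmp: "spectral_int s T \<le> T powr (K * \<bar>s - s'\<bar>) * spectral_int s' T" if T: "T1 \<le> T" for T s s'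
  proof (rule spectral_int_mono)
    fix y assume y: "y \<in> base_set"
    have D: "T powr (- K) \<le> rescaled_deriv T y" "rescaled_deriv T y \<le> T powr K"
      using bd[OF T y] by auto
    have pos: "0 < T powr (- K)"
      using T K by simp
    have "rescaled_deriv T y powr (s - s') \<le> T powr (K * \<bar>s - s'\<bar>)"
    proof (cases "s' \<le> s")
      case True
      have "rescaled_deriv T y powr (s - s') \<le> (T powr K) powr (s - s')"
        using True by (intro powr_mono2 D order_trans[OF less_imp_le[OF pos] D(1)]) auto
      then show ?thesis
        using True by (simp add: powr_powr)
    next
      case False
      have "rescaled_deriv T y powr (s - s') \<le> (T powr (- K)) powr (s - s')"
        using D pos False by (intro powr_mono2') auto
      then show ?thesis
        using False by (simp add: powr_powr algebra_simps)
    qed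
    then have "rescaled_deriv T y powr (s - s') * rescaled_deriv T y powr s'
        \<le> T powr (K * \<bar>s - s'\<bar>) * rescaled_deriv T y powr s'"
      by (intro mult_right_mono) auto
    then show "rescaled_deriv T y powr s \<le> T powr (K * \<bar>s - s'\<bar>) * rescaled_deriv T y powr s'"
      by (simp flip: powr_add)
  qed (use T K in auto)
  have pos: "0 < spectral_int s T" if T: "T1 \<le> T" for T s
  proof -
    \<comment> \<open>Positivity comes from comparison with the exponent 0, where the integral is
      2.\<close>
    have "2 \<le> T powr (K * \<bar>0 - s\<bar>) * spectral_int s T"
      using cmp[OF T, of 0 s] spectral_int_zero[of T] T K by simp
    then have "0 < T powr (K * \<bar>0 - s\<bar>) * spectral_int s T"
      by linarith
    then show ?thesis
      by (simp add: zero_less_mult_iff)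
  qed
  show thesis
  proof (rule that[OF K])
    fix T s s' assume T: "T1 \<le> T"
    have lnT: "0 < ln T"
      using T K by simp
    have "ln (spectral_int s T) \<le> ln (T powr (K * \<bar>s - s'\<bar>) * spectral_int s' T)"
      using cmp[OF T] pos[OF T] T K by (subst ln_le_cancel_iff) auto
    also have "\<dots> = K * \<bar>s - s'\<bar> * ln T + ln (spectral_int s' T)"
      using pos[OF T, of s'] T K by (simp add: ln_mult ln_powr)
    finally show "ln (spectral_int s T) / ln T \<le> ln (spectral_int s' T) / ln T + K * \<bar>s - s'\<bar>"
      using lnT by (simp add: divide_le_eq distrib_right)
  qed (use pos in auto)
qed

lemma beta_infty_eq: "beta_infty \<Omega> \<tau> j s = Limsup at_top (\<lambda>T. ereal (ln (spectral_int s T) / ln T))"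
  by (simp add: beta_infty_def beta_int_eq)

lemma beta_infty_lipschitz:
  obtains K where "\<And>s s'. 0 \<le> s \<Longrightarrow> 0 \<le> s' \<Longrightarrow>
    beta_infty \<Omega> \<tau> j s \<le> beta_infty \<Omega> \<tau> j s' + ereal (K * \<bar>s - s'\<bar>)"
proof -
  obtain K T1 where K: "0 \<le> K" "2 \<le> T1" and
    cmp: "\<And>T s s'. T1 \<le> T \<Longrightarrow> 0 \<le> s \<Longrightarrow> 0 \<le> s' \<Longrightarrow>
      ln (spectral_int s T) / ln T \<le> ln (spectral_int s' T) / ln T + K * \<bar>s - s'\<bar>"
    using spectral_int_comparison by metis
  show thesis
  proof (rule that)
    fix s s' :: real assume s: "0 \<le> s" "0 \<le> s'"
    have "beta_infty \<Omega> \<tau> j s \<le> Limsup at_top (\<lambda>T. ereal (ln (spectral_int s' T) / ln T) + ereal (K * \<bar>s - s'\<bar>))"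
      unfolding beta_infty_eq
      by (intro Limsup_mono eventually_mono[OF eventually_ge_at_top[of T1]]) (simp add: cmp s)
    also have "\<dots> = beta_infty \<Omega> \<tau> j s' + ereal (K * \<bar>s - s'\<bar>)"
      unfolding beta_infty_eq by (subst Limsup_add_ereal_right) auto
    finally show "beta_infty \<Omega> \<tau> j s \<le> beta_infty \<Omega> \<tau> j s' + ereal (K * \<bar>s - s'\<bar>)" .
  qed
qed

lemma beta_infty_zero: "beta_infty \<Omega> \<tau> j 0 = 0"
proof -
  have "((\<lambda>T::real. ln 2 / ln T) \<longlongrightarrow> 0) at_top"
    by (intro tendsto_divide_0[OF tendsto_const] filterlim_at_top_imp_at_infinity ln_at_top)
  then have "((\<lambda>T. ereal (ln 2 / ln T)) \<longlongrightarrow> 0) at_top"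
    by (simp add: zero_ereal_def)
  then have "Limsup at_top (\<lambda>T. ereal (ln 2 / ln T)) = 0"
    by (intro lim_imp_Limsup) auto
  moreover have "beta_infty \<Omega> \<tau> j 0 = Limsup at_top (\<lambda>T. ereal (ln 2 / ln T))"
    unfolding beta_infty_eq
    by (intro Limsup_eq eventually_mono[OF eventually_gt_at_top[of 0]]) (simp add: spectral_int_zero)
  ultimately show ?thesis
    by simp
qed

text \<open>Prepares the intermediate value theorem. The limit superior could a priori be infinite;
  the Lipschitz bound against the exponent 0, where it is 0, excludes this.\<close>

lemma b_infty_real_continuous:
  obtains b where "continuous_on {0..} b" and "b 0 = 1"
    and "\<And>s. 0 \<le> s \<Longrightarrow> b_infty_j \<Omega> \<tau> j s = ereal (b s)"
proof -
  obtain K where lip: "\<And>s s'. 0 \<le> s \<Longrightarrow> 0 \<le> s' \<Longrightarrow>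
      beta_infty \<Omega> \<tau> j s \<le> beta_infty \<Omega> \<tau> j s' + ereal (K * \<bar>s - s'\<bar>)"
    using beta_infty_lipschitz by blast
  define \<beta> where "\<beta> s = real_of_ereal (beta_infty \<Omega> \<tau> j s)" for s
  have \<beta>: "beta_infty \<Omega> \<tau> j s = ereal (\<beta> s)" if "0 \<le> s" for s
    using lip[OF that, of 0] lip[of 0 s] that beta_infty_zero unfolding \<beta>_def
    by (cases "beta_infty \<Omega> \<tau> j s") auto
  have lip': "\<beta> s \<le> \<beta> s' + K * \<bar>s - s'\<bar>" if "0 \<le> s" "0 \<le> s'" for s s'
    using lip[OF that] that by (simp add: \<beta>)
  \<comment> \<open>The two inequalities between the exponents 0 and 1 add up to
    \<open>0 \<le> 2 * K\<close>.\<close>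
  have "0 \<le> K"
    using lip'[of 0 1] lip'[of 1 0] by simp
  have "K-lipschitz_on {0..} \<beta>"
  proof (rule lipschitz_onI)
    show "dist (\<beta> s) (\<beta> s') \<le> K * dist s s'" if "s \<in> {0..}" "s' \<in> {0..}" for s s'
      using lip'[of s s'] lip'[of s' s] that by (simp add: dist_real_def abs_le_iff abs_minus_commute)
  qed fact
  then have "continuous_on {0..} \<beta>"
    by (rule lipschitz_on_continuous_on)
  show thesis
  proof (rule that[of "\<lambda>s. \<beta> s - s + 1"])
    show "continuous_on {0..} (\<lambda>s. \<beta> s - s + 1)"
      by (intro continuous_intros) fact
    show "\<beta> 0 - 0 + 1 = 1"
      using beta_infty_zero by (simp add: \<beta>_def)
    show "b_infty_j \<Omega> \<tau> j s = ereal (\<beta> s - s + 1)" if "0 \<le> s" for s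
      using that by (simp add: b_infty_j_def \<beta> one_ereal_def)
  qed
qed

text \<open>With \<open>J T\<close> the unscaled integral, the annulus has mass
  \<open>T * J T\<close>, while \<open>spectral_int s T\<close> is comparable to
  \<open>T powr s * J T\<close>. Hence the mass is comparable to
  \<open>T powr (1 - s) * spectral_int s T\<close>, whose growth exponent is what
  \<open>b_infty_j\<close> measures.\<close>

lemma spectral_int_line_mass:
  assumes s: "0 \<le> s"
  shows "\<exists>C>0. \<exists>T1\<ge>1. \<forall>T\<ge>T1.
    emeasure (line_mass s) {u. T \<le> \<bar>u\<bar> \<and> \<bar>u\<bar> \<le> 2 * T}
      \<le> ennreal (C * T powr (1 - s) * spectral_int s T) \<and>
    ennreal (spectral_int s T)
      \<le> ennreal (C * T powr (s - 1)) * emeasure (line_mass s) {u. T \<le> \<bar>u\<bar> \<and> \<bar>u\<bar> \<le> 2 * T}"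
proof -
  obtain C T1 where C: "1 \<le> C" "1 \<le> T1"
    and up: "\<And>T y. T1 \<le> T \<Longrightarrow> y \<in> base_set \<Longrightarrow> rescaled_deriv T y \<le> C * T * norm (deriv \<psi> (Complex 1 (T * y)))"
    and lo: "\<And>T y. T1 \<le> T \<Longrightarrow> y \<in> base_set \<Longrightarrow> T * norm (deriv \<psi> (Complex 1 (T * y))) \<le> C * rescaled_deriv T y"
    using rescaled_deriv_bounds by blast
  define J where "J T = integral base_set (\<lambda>y. norm (deriv \<psi> (Complex 1 (T * y))) powr s)" for T
  have int: "(\<lambda>y. norm (deriv \<psi> (Complex 1 (T * y))) powr s) integrable_on base_set" for T
  proof (rule integrable_on_base_set)
    have "continuous_on UNIV ((\<lambda>u. norm (deriv \<psi> (Complex 1 u)) powr s) \<circ> (\<lambda>y. T * y))"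
      by (intro continuous_on_compose continuous_on_line continuous_intros)
    then show "continuous_on UNIV (\<lambda>y. norm (deriv \<psi> (Complex 1 (T * y))) powr s)"
      by (simp add: o_def)
  qed
  have J0: "0 \<le> J T" for T
    unfolding J_def by (intro integral_nonneg int) auto
  have int': "(\<lambda>y. rescaled_deriv T y powr s) integrable_on base_set" if "T1 \<le> T" for T
    by (intro integrable_on_base_set continuous_on_rescaled_deriv) (use that C in auto)
  have D0: "0 \<le> rescaled_deriv T y" for T y
    by (simp add: rescaled_deriv_def)
  have 1: "spectral_int s T \<le> C powr s * T powr s * J T" if T: "T1 \<le> T" for T
  proof -
    have "spectral_int s T \<le> integral base_set (\<lambda>y. (C powr s * T powr s) * norm (deriv \<psi> (Complex 1 (T * y))) powr s)"
      unfolding spectral_int_def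
    proof (intro integral_le int' T integrable_on_mult_right int)
      fix y assume y: "y \<in> base_set"
      have "rescaled_deriv T y powr s \<le> (C * T * norm (deriv \<psi> (Complex 1 (T * y)))) powr s"
        by (intro powr_mono2 s D0 up T y)
      then show "rescaled_deriv T y powr s \<le> (C powr s * T powr s) * norm (deriv \<psi> (Complex 1 (T * y))) powr s"
        using C T by (simp add: powr_mult)
    qed
    then show ?thesis
      by (simp add: J_def)
  qed
  have 2: "T powr s * J T \<le> C powr s * spectral_int s T" if T: "T1 \<le> T" for T
  proof -
    have "integral base_set (\<lambda>y. T powr s * norm (deriv \<psi> (Complex 1 (T * y))) powr s)
        \<le> integral base_set (\<lambda>y. C powr s * rescaled_deriv T y powr s)"
    proof (intro integral_le int' T integrable_on_mult_right int)
      fix y assume y: "y \<in> base_set"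
      have "(T * norm (deriv \<psi> (Complex 1 (T * y)))) powr s \<le> (C * rescaled_deriv T y) powr s"
        by (intro powr_mono2 s lo T y) (use T C in auto)
      then show "T powr s * norm (deriv \<psi> (Complex 1 (T * y))) powr s \<le> C powr s * rescaled_deriv T y powr s"
        using C T D0 by (simp add: powr_mult)
    qed
    then show ?thesis
      by (simp add: J_def spectral_int_def)
  qed
  have mass: "emeasure (line_mass s) {u. T \<le> \<bar>u\<bar> \<and> \<bar>u\<bar> \<le> 2 * T} = ennreal (T * J T)" if "T1 \<le> T" for T
    using line_mass_annulus[of T s] that C by (simp add: J_def)
  show ?thesis
  proof (rule exI[of _ "C powr s"], intro conjI exI[of _ T1] allI impI)
    show "0 < C powr s" "1 \<le> T1"
      using C by auto
    fix T assume T: "T1 \<le> T"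
    have T_powr: "T powr (1 - s) * T powr s = T" "T powr (s - 1) * T = T powr s"
      using T C by (auto simp flip: powr_add) (simp add: powr_mult_base mult.commute)
    have "T * J T = T powr (1 - s) * (T powr s * J T)"
      using T_powr by (simp flip: mult.assoc)
    also have "\<dots> \<le> T powr (1 - s) * (C powr s * spectral_int s T)"
      using 2[OF T] by (rule mult_left_mono) simp
    finally show "emeasure (line_mass s) {u. T \<le> \<bar>u\<bar> \<and> \<bar>u\<bar> \<le> 2 * T}
        \<le> ennreal (C powr s * T powr (1 - s) * spectral_int s T)"
      unfolding mass[OF T] by (intro ennreal_leI) (simp add: mult_ac)
    have "C powr s * T powr s * J T = (C powr s * T powr (s - 1)) * (T * J T)"
      unfolding T_powr(2)[symmetric] by (simp only: mult_ac)
    then have "spectral_int s T \<le> (C powr s * T powr (s - 1)) * (T * J T)"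
      using 1[OF T] by (simp only:)
    then show "ennreal (spectral_int s T)
        \<le> ennreal (C powr s * T powr (s - 1)) * emeasure (line_mass s) {u. T \<le> \<bar>u\<bar> \<and> \<bar>u\<bar> \<le> 2 * T}"
      unfolding mass[OF T] using T C J0
      by (subst ennreal_mult[symmetric]) (auto intro!: ennreal_leI)
  qed
qed

text \<open>For \<open>c\<close> strictly between the spectrum at \<open>s\<close> and
  \<open>s - 1\<close>, the spectral integral is eventually below \<open>T powr c\<close>, so the
  annulus at scale \<open>T\<close> has mass at most \<open>C * T powr (- \<epsilon>)\<close>. The
  dyadic annuli outside a compact interval then add up like a geometric series.\<close>

lemma line_mass_finite_of_b_infty_neg:
  assumes s: "0 \<le> s" and neg: "b_infty_j \<Omega> \<tau> j s < 0"
  shows "emeasure (line_mass s) UNIV < \<infinity>"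
proof -
  obtain c where c: "beta_infty \<Omega> \<tau> j s < ereal c" "c < s - 1"
  proof -
    have "beta_infty \<Omega> \<tau> j s < ereal (s - 1)"
      using neg by (cases "beta_infty \<Omega> \<tau> j s") (auto simp: b_infty_j_def one_ereal_def zero_ereal_def)
    then obtain x where x: "beta_infty \<Omega> \<tau> j s < x" "x < ereal (s - 1)"
      using dense by blast
    then show thesis
      using that by (cases x) auto
  qed
  define \<epsilon> where "\<epsilon> = s - 1 - c"
  have \<epsilon>: "0 < \<epsilon>"
    using c by (simp add: \<epsilon>_def)
  obtain C T1 where C: "0 < C" "1 \<le> T1" and
    mass: "\<And>T. T1 \<le> T \<Longrightarrow> emeasure (line_mass s) {u. T \<le> \<bar>u\<bar> \<and> \<bar>u\<bar> \<le> 2 * T}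
      \<le> ennreal (C * T powr (1 - s) * spectral_int s T)"
    using spectral_int_line_mass[OF s] by blast
  obtain K T2 where T2: "2 \<le> T2" and pos: "\<And>T s. T2 \<le> T \<Longrightarrow> 0 \<le> s \<Longrightarrow> 0 < spectral_int s T"
    using spectral_int_comparison by metis
  have "\<forall>\<^sub>F T in at_top. ereal (ln (spectral_int s T) / ln T) < ereal c"
    using c(1) unfolding beta_infty_eq by (rule Limsup_lessD)
  then obtain T3 where T3: "\<And>T. T3 \<le> T \<Longrightarrow> ln (spectral_int s T) / ln T < c"
    by (auto simp: eventually_at_top_linorder)
  define R where "R = Max {T1, T2, T3}"
  have R: "T1 \<le> R" "T2 \<le> R" "T3 \<le> R" "0 < R"
    using C by (auto simp: R_def less_max_iff_disj)
  have ann: "emeasure (line_mass s) {u. T \<le> \<bar>u\<bar> \<and> \<bar>u\<bar> \<le> 2 * T} \<le> ennreal (C * T powr (- \<epsilon>))" if T: "R \<le> T" for T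
  proof -
    have lnT: "0 < ln T"
      using T R T2 by simp
    have "ln (spectral_int s T) < c * ln T"
      using T3[of T] T R lnT by (simp add: divide_less_eq)
    then have "spectral_int s T \<le> exp (c * ln T)"
      using pos[of T s] s T R by (metis exp_le_cancel_iff exp_ln less_imp_le order_trans)
    then have "spectral_int s T \<le> T powr c"
      using T R by (simp add: powr_def)
    then have "C * T powr (1 - s) * spectral_int s T \<le> C * T powr (1 - s) * T powr c"
      using C by (intro mult_left_mono) auto
    also have "\<dots> = C * T powr (- \<epsilon>)"
      by (simp add: \<epsilon>_def mult.assoc algebra_simps flip: powr_add)
    finally have "ennreal (C * T powr (1 - s) * spectral_int s T) \<le> ennreal (C * T powr (- \<epsilon>))"
      by (rule ennreal_leI)
    then show ?thesis
      using mass[of T] T R by (meson order_trans)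
  qed
  define A where "A n = {u. 2 ^ n * R \<le> \<bar>u\<bar> \<and> \<bar>u\<bar> \<le> 2 * (2 ^ n * R)}" for n :: nat
  have A_sets: "A n \<in> sets borel" for n
    unfolding A_def by measurable
  have cover: "UNIV \<subseteq> {- R..R} \<union> (\<Union>n. A n)"
  proof
    fix u :: real
    show "u \<in> {- R..R} \<union> (\<Union>n. A n)"
    proof (cases "\<bar>u\<bar> \<le> R")
      case False
      obtain n0 where n0: "\<bar>u\<bar> / R < 2 ^ n0"
        using real_arch_pow[of 2 "\<bar>u\<bar> / R"] by auto
      \<comment> \<open>The least such \<open>n\<close> is positive, and its predecessor is the
        index of an annulus that contains \<open>u\<close>.\<close>
      define n where "n = (LEAST n. \<bar>u\<bar> < 2 ^ n * R)"
      have ex: "\<bar>u\<bar> < 2 ^ n0 * R"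
        using n0 R by (simp add: divide_less_eq)
      have n: "\<bar>u\<bar> < 2 ^ n * R"
        unfolding n_def by (rule LeastI) (rule ex)
      have "n \<noteq> 0"
        using n False by (metis mult_1 not_less_iff_gr_or_eq not_le power_0 less_imp_le)
      then obtain m where m: "n = Suc m"
        using not0_implies_Suc by blast
      have "\<not> \<bar>u\<bar> < 2 ^ m * R"
        using not_less_Least[of m "\<lambda>n. \<bar>u\<bar> < 2 ^ n * R"] m n_def by simp
      then have "u \<in> A m"
        using n m by (simp add: A_def)
      then show ?thesis by blast
    qed auto
  qed
  have A_le: "emeasure (line_mass s) (A n) \<le> ennreal (C * R powr (- \<epsilon>) * (2 powr (- \<epsilon>)) ^ n)" for n
  proof -
    have "R \<le> 2 ^ n * R"
      using R by simp
    then have "emeasure (line_mass s) (A n) \<le> ennreal (C * (2 ^ n * R) powr (- \<epsilon>))"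
      unfolding A_def by (rule ann)
    moreover have "(2 ^ n * R) powr (- \<epsilon>) = R powr (- \<epsilon>) * (2 powr (- \<epsilon>)) ^ n"
      using R by (simp add: powr_mult powr_power flip: powr_realpow) (simp add: powr_powr mult.commute)
    ultimately show ?thesis
      by (simp add: mult.assoc)
  qed
  have summ: "summable (\<lambda>n. C * R powr (- \<epsilon>) * (2 powr (- \<epsilon>)) ^ n)"
    using \<epsilon> by (intro summable_mult summable_geometric) (simp add: powr_less_one)
  have "emeasure (line_mass s) (\<Union>n. A n) \<le> (\<Sum>n. emeasure (line_mass s) (A n))"
    by (rule emeasure_subadditive_countably) (use A_sets in auto)
  also have "\<dots> \<le> (\<Sum>n. ennreal (C * R powr (- \<epsilon>) * (2 powr (- \<epsilon>)) ^ n))"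
    by (intro suminf_le A_le summableI)
  also have "\<dots> = ennreal (\<Sum>n. C * R powr (- \<epsilon>) * (2 powr (- \<epsilon>)) ^ n)"
    using C summ by (intro suminf_ennreal2) auto
  also have "\<dots> < \<infinity>"
    by simp
  finally have tail: "emeasure (line_mass s) (\<Union>n. A n) < \<infinity>" .
  have "emeasure (line_mass s) UNIV \<le> emeasure (line_mass s) ({- R..R} \<union> (\<Union>n. A n))"
    using cover A_sets by (intro emeasure_mono) auto
  also have "\<dots> \<le> emeasure (line_mass s) {- R..R} + emeasure (line_mass s) (\<Union>n. A n)"
    using A_sets by (intro emeasure_subadditive) auto
  also have "\<dots> < \<infinity>"
    using tail line_mass_interval_finite[OF s, of "- R" R] by simp
  finally show ?thesis .
qed

text \<open>Every annulus has at most the total mass, so the spectral integral is at most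
  \<open>V * T powr (s - 1)\<close>; the constant \<open>V\<close> disappears on division by
  \<open>ln T\<close>.\<close>

lemma b_infty_nonpos_of_line_mass_finite:
  assumes s: "0 \<le> s" and fin: "emeasure (line_mass s) UNIV < \<infinity>"
  shows "b_infty_j \<Omega> \<tau> j s \<le> 0"
proof -
  obtain C T1 where C: "0 < C" "1 \<le> T1" and
    mass: "\<And>T. T1 \<le> T \<Longrightarrow> ennreal (spectral_int s T)
      \<le> ennreal (C * T powr (s - 1)) * emeasure (line_mass s) {u. T \<le> \<bar>u\<bar> \<and> \<bar>u\<bar> \<le> 2 * T}"
    using spectral_int_line_mass[OF s] by blast
  obtain K T2 where T2: "2 \<le> T2" and pos: "\<And>T s. T2 \<le> T \<Longrightarrow> 0 \<le> s \<Longrightarrow> 0 < spectral_int s T"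
    using spectral_int_comparison by metis
  obtain m where m: "0 \<le> m" "emeasure (line_mass s) UNIV = ennreal m"
    using fin by (cases "emeasure (line_mass s) UNIV") auto
  \<comment> \<open>\<open>m + 1\<close> instead of \<open>m\<close>, so that \<open>ln V\<close> is
    the logarithm of a positive number even if \<open>m = 0\<close>.\<close>
  define V where "V = C * (m + 1)"
  have V: "0 < V"
    using C m by (simp add: V_def)
  have le: "ln (spectral_int s T) / ln T \<le> s - 1 + ln V / ln T" if T: "max T1 T2 \<le> T" for T
  proof -
    have lnT: "0 < ln T" and T0: "0 < T"
      using T T2 by auto
    have "emeasure (line_mass s) {u. T \<le> \<bar>u\<bar> \<and> \<bar>u\<bar> \<le> 2 * T} \<le> ennreal m"
      unfolding m(2)[symmetric] by (intro emeasure_mono) auto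
    then have "ennreal (spectral_int s T) \<le> ennreal (C * T powr (s - 1)) * ennreal m"
      using mass[of T] T by (meson max.boundedE mult_left_mono order_trans zero_le)
    then have "spectral_int s T \<le> C * T powr (s - 1) * m"
      using C m by (simp flip: ennreal_mult)
    also have "\<dots> \<le> V * T powr (s - 1)"
      using C by (simp add: V_def algebra_simps)
    finally have "ln (spectral_int s T) \<le> ln (V * T powr (s - 1))"
      using pos[of T s] T s V T0 by (subst ln_le_cancel_iff) auto
    also have "\<dots> = ln V + (s - 1) * ln T"
      using V T0 by (simp add: ln_mult ln_powr)
    finally show ?thesis
      using lnT by (simp add: field_simps)
  qed
  have "((\<lambda>T. s - 1 + ln V / ln T) \<longlongrightarrow> s - 1 + 0) at_top"
    by (intro tendsto_add tendsto_const tendsto_divide_0[OF tendsto_const]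
        filterlim_at_top_imp_at_infinity ln_at_top)
  then have "((\<lambda>T. ereal (s - 1 + ln V / ln T)) \<longlongrightarrow> ereal (s - 1)) at_top"
    by simp
  then have "Limsup at_top (\<lambda>T. ereal (s - 1 + ln V / ln T)) = ereal (s - 1)"
    by (intro lim_imp_Limsup) auto
  moreover have "beta_infty \<Omega> \<tau> j s \<le> Limsup at_top (\<lambda>T. ereal (s - 1 + ln V / ln T))"
    unfolding beta_infty_eq
    by (intro Limsup_mono eventually_mono[OF eventually_ge_at_top[of "max T1 T2"]]) (use le in auto)
  ultimately have "beta_infty \<Omega> \<tau> j s \<le> ereal (s - 1)"
    by simp
  then show ?thesis
    by (cases "beta_infty \<Omega> \<tau> j s") (auto simp: b_infty_j_def one_ereal_def zero_ereal_def)
qed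

text \<open>The intermediate value theorem between the value 1 at exponent 0 and the nonpositive
  value at \<open>s\<close>.\<close>

lemma b_infty_zero_of_line_mass_finite:
  assumes s: "0 \<le> s" and fin: "emeasure (line_mass s) UNIV < \<infinity>"
  obtains r where "0 < r" and "r \<le> s" and "b_infty_j \<Omega> \<tau> j r = 0"
proof -
  obtain b where b: "continuous_on {0..} b" "b 0 = 1" "\<And>s. 0 \<le> s \<Longrightarrow> b_infty_j \<Omega> \<tau> j s = ereal (b s)"
    using b_infty_real_continuous by blast
  have "b s \<le> 0"
    using b_infty_nonpos_of_line_mass_finite[OF s fin] b(3)[OF s] by (simp add: zero_ereal_def)
  then obtain r where r: "0 \<le> r" "r \<le> s" "b r = 0"
    using IVT2'[of b s 0 0] s b(1,2) continuous_on_subset[of "{0..}" b "{0..s}"] by auto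
  then have "r \<noteq> 0"
    using b(2) by auto
  then show thesis
    using that[of r] r b(3)[of r] by (simp add: zero_ereal_def)
qed

end

section \<open>The transfer operator\<close>

lemma (in log_tract) diff_le:
  assumes "1 \<le> Re z" "1 \<le> Re a" "norm (z - a) \<le> r"
  shows "norm (\<psi> z - \<psi> a) \<le> exp (\<kappa> * r) * r * norm (deriv \<psi> a)"
proof -
  have r: "0 \<le> r"
    using assms(3) norm_ge_zero order_trans by blast
  have "norm (\<psi> z - \<psi> a) \<le> exp (\<kappa> * r) * norm (deriv \<psi> a) * norm (z - a)"
  proof (rule field_differentiable_bound)
    show "convex ({z. 1 \<le> Re z} \<inter> cball a r)"
      by (intro convex_Int convex_halfspace_Re_ge convex_cball)
    fix x assume x: "x \<in> {z. 1 \<le> Re z} \<inter> cball a r"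
    then have "x \<in> right_half_plane"
      by (simp add: right_half_plane_def)
    then show "(\<psi> has_field_derivative deriv \<psi> x) (at x within {z. 1 \<le> Re z} \<inter> cball a r)"
      by (rule has_field_derivative_at_within[OF holomorphic_derivI[OF holo open_right_half_plane]])
    have "norm (x - a) \<le> r"
      using x by (simp add: dist_norm norm_minus_commute)
    then show "norm (deriv \<psi> x) \<le> exp (\<kappa> * r) * norm (deriv \<psi> a)"
      using harnack_powr[of 1 x a r 1] x assms(2) by simp
  qed (use assms r in \<open>auto simp: dist_norm norm_minus_commute\<close>)
  also have "\<dots> \<le> exp (\<kappa> * r) * norm (deriv \<psi> a) * r"
    using assms(3) by (intro mult_left_mono) auto
  finally show ?thesis
    by (simp add: mult_ac)
qed

text \<open>Finite mass makes \<open>norm (deriv \<psi>)\<close> summable along the points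
  \<open>1 + 2 * pi * \<i> * n\<close>, and by \<open>diff_le\<close> the increments of \<psi> as
  well. The points shifted by \<open>pi * \<i>\<close> are included because \<open>exp\<close>
  changes its sign there, which contradicts a common limit in the entire case.\<close>

lemma (in log_tract) limits_of_line_mass_finite:
  assumes fin: "emeasure (line_mass 1) UNIV < \<infinity>"
  obtains l where "(\<lambda>n. \<psi> (1 + of_int (2 * int n) * pi * \<i>)) \<longlonglongrightarrow> l"
    and "(\<lambda>n. \<psi> (1 + of_int (2 * int n) * pi * \<i> + pi * \<i>)) \<longlonglongrightarrow> l"
proof -
  define z where "z n = (1 + of_int (2 * int n) * pi * \<i> :: complex)" for n
  define a where "a n = norm (deriv \<psi> (z n))" for n
  have Re_z: "Re (z n) = 1" for n
    by (simp add: z_def)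
  obtain B where B: "\<And>\<xi> K :: int set. 1 \<le> Re \<xi> \<Longrightarrow> finite K \<Longrightarrow>
    (\<Sum>k\<in>K. norm (deriv \<psi> (\<xi> + of_int (2 * k) * pi * \<i>)) powr 1) \<le> B"
    using sum_powr_bounded[OF zero_le_one zero_less_one fin] by blast
  have sum_a: "summable a"
  proof (rule summableI_nonneg_bounded)
    fix n
    have "sum a {..<n} = (\<Sum>k\<in>int ` {..<n}. norm (deriv \<psi> (1 + of_int (2 * k) * pi * \<i>)) powr 1)"
      by (subst sum.reindex) (auto simp: a_def z_def)
    also have "\<dots> \<le> B"
      by (rule B) auto
    finally show "sum a {..<n} \<le> B" .
  qed (simp add: a_def)
  have step: "norm (\<psi> (z (Suc n)) - \<psi> (z n)) \<le> exp (\<kappa> * (2 * pi)) * (2 * pi) * a n" for n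
    unfolding a_def by (rule diff_le) (auto simp: Re_z, simp add: z_def algebra_simps norm_mult)
  have half: "norm (\<psi> (z n + pi * \<i>) - \<psi> (z n)) \<le> exp (\<kappa> * pi) * pi * a n" for n
    unfolding a_def by (rule diff_le) (auto simp: Re_z norm_mult)
  have "summable (\<lambda>n. exp (\<kappa> * (2 * pi)) * (2 * pi) * a n)"
    by (intro summable_mult sum_a)
  then have "summable (\<lambda>n. \<psi> (z (Suc n)) - \<psi> (z n))"
    by (rule summable_comparison_test'[where N = 0]) (rule step)
  then have "(\<lambda>n. \<Sum>k<n. \<psi> (z (Suc k)) - \<psi> (z k)) \<longlonglongrightarrow> (\<Sum>n. \<psi> (z (Suc n)) - \<psi> (z n))"
    by (rule summable_LIMSEQ)
  then have "(\<lambda>n. \<psi> (z n) - \<psi> (z 0)) \<longlonglongrightarrow> (\<Sum>n. \<psi> (z (Suc n)) - \<psi> (z n))"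
    by (simp only: sum_lessThan_telescope[of "\<lambda>k. \<psi> (z k)"])
  from tendsto_add[OF this tendsto_const[of "\<psi> (z 0)"]]
  obtain l where l: "(\<lambda>n. \<psi> (z n)) \<longlonglongrightarrow> l"
    by auto
  have "(\<lambda>n. exp (\<kappa> * pi) * pi * a n) \<longlonglongrightarrow> 0"
    by (intro tendsto_mult_right_zero summable_LIMSEQ_zero sum_a)
  then have "(\<lambda>n. \<psi> (z n + pi * \<i>) - \<psi> (z n)) \<longlonglongrightarrow> 0"
    by (rule Lim_null_comparison[rotated]) (use half in auto)
  from tendsto_add[OF this l] have "(\<lambda>n. \<psi> (z n + pi * \<i>)) \<longlonglongrightarrow> l"
    by simp
  with l show thesis
    using that by (simp add: z_def)
qed

section \<open>Inverse branches of a function in class D, and the series expressed through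
  them\<close>

locale class_D_tracts =
  fixes f :: "complex \<Rightarrow> complex" and N :: nat and \<Omega> :: "nat \<Rightarrow> complex set"
    and \<tau> :: "nat \<Rightarrow> complex \<Rightarrow> complex" and A :: "complex set"
  assumes classD: "(entire_class_D f N \<Omega> \<tau> \<and> A = UNIV) \<or>
                   (model_class_D f N \<Omega> \<tau> \<and> A = (\<Union>j<N. \<Omega> j))"
begin

abbreviation \<phi> where "\<phi> \<equiv> phi_map \<Omega> \<tau>"

lemma common: "class_D_common f N \<Omega> \<tau>"
  using classD by (auto simp: entire_class_D_def model_class_D_def)

lemma N_pos: "0 < N"
  using common by (simp add: class_D_common_def)

lemma tract_props:
  assumes "j < N"
  shows "open (\<Omega> j)" "\<tau> j holomorphic_on \<Omega> j" "inj_on (\<tau> j) (\<Omega> j)" "\<tau> j ` \<Omega> j = right_half_plane"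
    "\<And>z. z \<in> \<Omega> j \<Longrightarrow> f z = exp (\<tau> j z)"
  using common assms by (auto simp: class_D_common_def)

lemma tracts_disjoint: "i < N \<Longrightarrow> j < N \<Longrightarrow> z \<in> \<Omega> i \<Longrightarrow> z \<in> \<Omega> j \<Longrightarrow> i = j"
  using common unfolding class_D_common_def by blast

lemma norm_closure: "z \<in> closure (\<Union>j<N. \<Omega> j) \<Longrightarrow> 1 < norm z"
  using common by (auto simp: class_D_common_def disjoint_iff not_le)

lemma phi_in: "j < N \<Longrightarrow> 0 < Re \<xi> \<Longrightarrow> \<phi> j \<xi> \<in> \<Omega> j"
  unfolding phi_map_def by (rule inv_into_into) (simp add: tract_props right_half_plane_def)

lemma tau_phi: "j < N \<Longrightarrow> 0 < Re \<xi> \<Longrightarrow> \<tau> j (\<phi> j \<xi>) = \<xi>"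
  unfolding phi_map_def by (rule f_inv_into_f) (simp add: tract_props right_half_plane_def)

lemma phi_tau: "j < N \<Longrightarrow> z \<in> \<Omega> j \<Longrightarrow> \<phi> j (\<tau> j z) = z"
  unfolding phi_map_def by (rule inv_into_f_f) (simp_all add: tract_props)

lemma f_phi: "j < N \<Longrightarrow> 0 < Re \<xi> \<Longrightarrow> f (\<phi> j \<xi>) = exp \<xi>"
  by (simp add: tract_props(5)[OF _ phi_in] tau_phi)

lemma phi_nonzero: "j < N \<Longrightarrow> 0 < Re \<xi> \<Longrightarrow> \<phi> j \<xi> \<noteq> 0"
  using norm_closure[of "\<phi> j \<xi>"] phi_in[of j \<xi>] closure_subset[of "\<Union>j<N. \<Omega> j"] by fastforce

lemma phi_holo:
  assumes j: "j < N"
  shows "\<phi> j holomorphic_on right_half_plane"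
proof -
  obtain g where g: "g holomorphic_on \<tau> j ` \<Omega> j" "\<And>z. z \<in> \<Omega> j \<Longrightarrow> g (\<tau> j z) = z"
    using holomorphic_has_inverse[OF tract_props(2,1,3)[OF j]] by metis
  have "\<phi> j \<xi> = g \<xi>" if "\<xi> \<in> right_half_plane" for \<xi>
    using g(2)[OF phi_in[OF j, of \<xi>]] tau_phi[OF j, of \<xi>] that by (simp add: right_half_plane_def)
  then show ?thesis
    using g(1) tract_props(4)[OF j] by (metis holomorphic_transform)
qed

text \<open>The tracts avoid the closed unit disc and hence 0, so \<open>\<phi> j\<close> has a
  logarithm on the convex half-plane; its exponential is injective because \<open>\<tau> j\<close>
  undoes \<open>\<phi> j\<close>.\<close>

lemma spectral_tract_exists:
  assumes j: "j < N"
  shows "\<exists>\<psi> M T0. spectral_tract \<psi> \<Omega> \<tau> j M T0"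
proof -
  obtain \<psi> where \<psi>: "\<psi> holomorphic_on right_half_plane" "\<And>\<xi>. \<xi> \<in> right_half_plane \<Longrightarrow> exp (\<psi> \<xi>) = \<phi> j \<xi>"
    using holomorphic_logarithm_exists[OF convex_right_half_plane open_right_half_plane phi_holo[OF j], of 1]
      phi_nonzero[OF j] by (auto simp: right_half_plane_def)
  have "\<forall>j<N. \<exists>M T0. \<forall>T\<ge>T0. \<forall>\<xi> \<xi>'. \<xi> \<in> Qsq T - Qsq (T / 8) \<longrightarrow> \<xi>' \<in> Qsq T - Qsq (T / 8) \<longrightarrow>
        norm (\<phi> j \<xi>) \<le> M * norm (\<phi> j \<xi>')"
    using common unfolding class_D_common_def by (elim conjE)
  then obtain M T0 where M: "\<forall>T\<ge>T0. \<forall>\<xi> \<xi>'. \<xi> \<in> Qsq T - Qsq (T / 8) \<longrightarrow> \<xi>' \<in> Qsq T - Qsq (T / 8) \<longrightarrow>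
        norm (\<phi> j \<xi>) \<le> M * norm (\<phi> j \<xi>')"
    using j by meson
  have "inj_on (\<lambda>\<xi>. exp (\<psi> \<xi>)) right_half_plane"
  proof (rule inj_onI)
    fix x y assume xy: "x \<in> right_half_plane" "y \<in> right_half_plane" and "exp (\<psi> x) = exp (\<psi> y)"
    then have "\<phi> j x = \<phi> j y"
      using \<psi>(2) by metis
    moreover have "\<tau> j (\<phi> j x) = x" "\<tau> j (\<phi> j y) = y"
      using xy by (auto intro: tau_phi[OF j] simp: right_half_plane_def)
    ultimately show "x = y"
      by metis
  qed
  then have "spectral_tract \<psi> \<Omega> \<tau> j M T0"
  proof (intro spectral_tract.intro log_tract.intro spectral_tract_axioms.intro \<psi>(1))
    show "exp (\<psi> \<xi>) = \<phi> j \<xi>" if "0 < Re \<xi>" for \<xi>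
      using \<psi>(2) that by (simp add: right_half_plane_def)
    show "norm (\<phi> j \<xi>) \<le> M * norm (\<phi> j \<xi>')"
      if "T0 \<le> T" "\<xi> \<in> Qsq T - Qsq (T / 8)" "\<xi>' \<in> Qsq T - Qsq (T / 8)" for T \<xi> \<xi>'
      using M that by blast
  qed
  then show ?thesis by blast
qed

text \<open>Differentiating \<open>f (\<phi> j \<xi>) = exp \<xi>\<close> with
  \<open>\<phi> j = exp \<psi>\<close> gives
  \<open>deriv f * \<phi> j \<xi> * deriv \<psi> \<xi> = exp \<xi>\<close>, so
  \<open>log_deriv_norm f\<close> at \<open>\<phi> j \<xi>\<close> is the reciprocal of
  \<open>norm (deriv \<psi> \<xi>)\<close>.\<close>

lemma transfer_term_phi:
  assumes j: "j < N" and \<psi>: "spectral_tract \<psi> \<Omega> \<tau> j M T0" and \<xi>: "0 < Re \<xi>"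
  shows "transfer_term f t (\<phi> j \<xi>) = norm (deriv \<psi> \<xi>) powr t"
proof -
  interpret spectral_tract \<psi> \<Omega> \<tau> j M T0 by (rule \<psi>)
  have \<xi>H: "\<xi> \<in> right_half_plane"
    using \<xi> by (simp add: right_half_plane_def)
  have "(\<tau> j has_field_derivative deriv (\<tau> j) (\<phi> j \<xi>)) (at (\<phi> j \<xi>))"
    by (rule holomorphic_derivI[OF tract_props(2,1)[OF j] phi_in[OF j \<xi>]])
  then have "((\<lambda>z. exp (\<tau> j z)) has_field_derivative exp (\<tau> j (\<phi> j \<xi>)) * deriv (\<tau> j) (\<phi> j \<xi>)) (at (\<phi> j \<xi>))"
    by (auto intro!: derivative_eq_intros)
  then have "(f has_field_derivative exp (\<tau> j (\<phi> j \<xi>)) * deriv (\<tau> j) (\<phi> j \<xi>)) (at (\<phi> j \<xi>))"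
    by (rule has_field_derivative_transform_within_open[OF _ tract_props(1)[OF j] phi_in[OF j \<xi>]])
       (simp add: tract_props(5)[OF j])
  then have f_der: "(f has_field_derivative deriv f (\<phi> j \<xi>)) (at (\<phi> j \<xi>))"
    by (simp add: DERIV_imp_deriv)
  have "((\<lambda>\<xi>. exp (\<psi> \<xi>)) has_field_derivative exp (\<psi> \<xi>) * deriv \<psi> \<xi>) (at \<xi>)"
    using holomorphic_derivI[OF holo open_right_half_plane \<xi>H] by (auto intro!: derivative_eq_intros)
  then have "(\<phi> j has_field_derivative \<phi> j \<xi> * deriv \<psi> \<xi>) (at \<xi>)"
    unfolding exp_eq[OF \<xi>]
    by (rule has_field_derivative_transform_within_open[OF _ open_right_half_plane \<xi>H])
       (simp add: exp_eq right_half_plane_def)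
  with f_der have "((\<lambda>\<xi>. f (\<phi> j \<xi>)) has_field_derivative deriv f (\<phi> j \<xi>) * (\<phi> j \<xi> * deriv \<psi> \<xi>)) (at \<xi>)"
    by (rule DERIV_chain2)
  then have "(exp has_field_derivative deriv f (\<phi> j \<xi>) * (\<phi> j \<xi> * deriv \<psi> \<xi>)) (at \<xi>)"
    by (rule has_field_derivative_transform_within_open[OF _ open_right_half_plane \<xi>H])
       (simp add: f_phi j right_half_plane_def)
  then have "deriv f (\<phi> j \<xi>) * (\<phi> j \<xi> * deriv \<psi> \<xi>) = exp \<xi>"
    using DERIV_unique DERIV_exp by blast
  from arg_cong[OF this, of norm]
  have "norm (deriv f (\<phi> j \<xi>)) * norm (\<phi> j \<xi>) * norm (deriv \<psi> \<xi>) = norm (exp \<xi>)"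
    by (simp only: norm_mult mult.assoc)
  moreover have "norm (deriv \<psi> \<xi>) \<noteq> 0"
    using deriv_nonzero[OF \<xi>] by simp
  ultimately have "log_deriv_norm f (\<phi> j \<xi>) = inverse (norm (deriv \<psi> \<xi>))"
    unfolding log_deriv_norm_def f_phi[OF j \<xi>] by (simp add: field_simps)
  then show ?thesis
    by (simp add: transfer_term_def powr_minus inverse_powr)
qed

text \<open>A preimage of \<open>w\<close> is determined by its tract and by the logarithm of
  \<open>w\<close> to which \<open>\<tau> j\<close> sends it. The logarithms are written in the form
  produced by \<open>Complex_Transcendental.exp_eq\<close>.\<close>

lemma preimage_bij:
  assumes w: "1 < norm w"
  shows "bij_betw (\<lambda>(j, k :: int). \<phi> j (Ln w + of_int (2 * k) * pi * \<i>)) ({..<N} \<times> UNIV) (preimage_in A f w)"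
proof -
  have w0: "w \<noteq> 0"
    using w by auto
  have Re: "Re (Ln w + of_int (2 * k) * pi * \<i>) = ln (norm w)" for k
    using w0 by simp
  have pos: "0 < Re (Ln w + of_int (2 * k) * pi * \<i>)" for k
    unfolding Re using w by (rule ln_gt_zero)
  have exp_eq: "exp (Ln w + of_int (2 * k) * pi * \<i>) = w" for k
  proof -
    have "exp (Ln w + of_int (2 * k) * pi * \<i>) = exp (Ln w)"
      unfolding exp_eq by blast
    then show ?thesis
      using w0 by simp
  qed
  have A: "(\<Union>j<N. \<Omega> j) \<subseteq> A"
    using classD by auto
  \<comment> \<open>For an entire function the tracts are all the components of the set where
    \<open>norm (f z) > 1\<close>; for a model function \<open>A\<close> is the union of the
    tracts.\<close>
  have tract: "\<exists>j<N. z \<in> \<Omega> j" if "z \<in> A" "f z = w" for z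
    using classD
  proof
    assume "entire_class_D f N \<Omega> \<tau> \<and> A = UNIV"
    then have comp: "\<Omega> ` {..<N} = components (f -` {w. norm w > 1})"
      by (simp add: entire_class_D_def)
    have "z \<in> \<Union> (components (f -` {w. norm w > 1}))"
      unfolding Union_components using that w by simp
    then show ?thesis
      unfolding comp[symmetric] by auto
  qed (use that in auto)
  show ?thesis
    unfolding bij_betw_def
  proof
    show "inj_on (\<lambda>(j, k). \<phi> j (Ln w + of_int (2 * k) * pi * \<i>)) ({..<N} \<times> UNIV)"
    proof (rule inj_onI, clarsimp simp only: mem_Sigma_iff lessThan_iff prod.case)
      fix i k j l assume ij: "i < N" "j < N" and eq: "\<phi> i (Ln w + of_int (2 * k) * pi * \<i>) = \<phi> j (Ln w + of_int (2 * l) * pi * \<i>)"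
      have "i = j"
        using tracts_disjoint[OF ij phi_in[OF ij(1) pos[of k]]] phi_in[OF ij(2) pos[of l]] eq by simp
      then have "Ln w + of_int (2 * k) * pi * \<i> = Ln w + of_int (2 * l) * pi * \<i>"
        using tau_phi[OF ij(1) pos[of k]] tau_phi[OF ij(2) pos[of l]] eq by metis
      then show "i = j \<and> k = l"
        using \<open>i = j\<close> by simp
    qed
    show "(\<lambda>(j, k). \<phi> j (Ln w + of_int (2 * k) * pi * \<i>)) ` ({..<N} \<times> UNIV) = preimage_in A f w"
    proof (intro equalityI subsetI)
      fix z assume "z \<in> (\<lambda>(j, k). \<phi> j (Ln w + of_int (2 * k) * pi * \<i>)) ` ({..<N} \<times> UNIV)"
      then obtain j k where j: "j < N" and z: "z = \<phi> j (Ln w + of_int (2 * k) * pi * \<i>)"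
        by auto
      have "z \<in> \<Omega> j" "f z = w"
        unfolding z by (rule phi_in[OF j pos], simp only: f_phi[OF j pos] exp_eq)
      then show "z \<in> preimage_in A f w"
        using A j by (auto simp: preimage_in_def)
    next
      fix z assume "z \<in> preimage_in A f w"
      then have z: "z \<in> A" "f z = w"
        by (auto simp: preimage_in_def)
      then obtain j where j: "j < N" "z \<in> \<Omega> j"
        using tract by blast
      have "exp (\<tau> j z) = exp (Ln w)"
        using tract_props(5)[OF j] z w0 by simp
      then obtain k where "\<tau> j z = Ln w + of_int (2 * k) * pi * \<i>"
        unfolding Complex_Transcendental.exp_eq by blast
      then have "z = \<phi> j (Ln w + of_int (2 * k) * pi * \<i>)"
        using phi_tau[OF j] by simp
      then show "z \<in> (\<lambda>(j, k). \<phi> j (Ln w + of_int (2 * k) * pi * \<i>)) ` ({..<N} \<times> UNIV)"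
        using j by auto
    qed
  qed
qed

lemma transfer_summable_iff:
  assumes w: "1 < norm w" and \<psi>: "\<And>j. j < N \<Longrightarrow> spectral_tract (\<psi> j) \<Omega> \<tau> j (M j) (T0 j)"
  shows "transfer_term f t summable_on preimage_in A f w \<longleftrightarrow>
      (\<lambda>(j, k :: int). norm (deriv (\<psi> j) (Ln w + of_int (2 * k) * pi * \<i>)) powr t) summable_on ({..<N} \<times> UNIV)"
    and "transfer_op A f t w =
      (\<Sum>\<^sub>\<infinity>(j, k :: int)\<in>{..<N} \<times> UNIV. norm (deriv (\<psi> j) (Ln w + of_int (2 * k) * pi * \<i>)) powr t)"
proof -
  have "w \<noteq> 0"
    using w by auto
  then have pos: "0 < Re (Ln w + of_int (2 * k) * pi * \<i>)" for k
    using w by (simp add: ln_gt_zero)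
  have eq: "transfer_term f t (case x of (j, k :: int) \<Rightarrow> \<phi> j (Ln w + of_int (2 * k) * pi * \<i>))
      = (case x of (j, k) \<Rightarrow> norm (deriv (\<psi> j) (Ln w + of_int (2 * k) * pi * \<i>)) powr t)"
    if "x \<in> {..<N} \<times> UNIV" for x
  proof (cases x)
    case (Pair j k)
    with that have "j < N" by simp
    then show ?thesis
      unfolding Pair prod.case by (intro transfer_term_phi[OF _ \<psi>] pos)
  qed
  show "transfer_term f t summable_on preimage_in A f w \<longleftrightarrow>
      (\<lambda>(j, k :: int). norm (deriv (\<psi> j) (Ln w + of_int (2 * k) * pi * \<i>)) powr t) summable_on ({..<N} \<times> UNIV)"
    unfolding summable_on_reindex_bij_betw[OF preimage_bij[OF w], symmetric]
    by (intro summable_on_cong eq)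
  show "transfer_op A f t w =
      (\<Sum>\<^sub>\<infinity>(j, k :: int)\<in>{..<N} \<times> UNIV. norm (deriv (\<psi> j) (Ln w + of_int (2 * k) * pi * \<i>)) powr t)"
    unfolding transfer_op_def infsum_reindex_bij_betw[OF preimage_bij[OF w], symmetric]
    by (intro infsum_cong eq)
qed

text \<open>Otherwise \<open>\<phi> j\<close> would have the finite limit \<open>exp l\<close> along
  two sequences going to infinity. An entire \<open>f\<close> is continuous at \<open>exp l\<close>,
  yet it is constantly \<open>exp 1\<close> on one image sequence and \<open>- exp 1\<close> on the
  other. For a model function, \<open>\<phi> j\<close> tends to infinity by assumption.\<close>

lemma line_mass_one_infinite:
  assumes j: "j < N" and \<psi>: "spectral_tract \<psi> \<Omega> \<tau> j M T0"
  shows "\<not> emeasure (log_tract.line_mass \<psi> 1) UNIV < \<infinity>"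
proof
  assume fin: "emeasure (log_tract.line_mass \<psi> 1) UNIV < \<infinity>"
  interpret spectral_tract \<psi> \<Omega> \<tau> j M T0 by (rule \<psi>)
  define z where "z n = (1 + of_int (2 * int n) * pi * \<i> :: complex)" for n
  have pos: "0 < Re (z n)" "0 < Re (z n + pi * \<i>)" for n
    by (auto simp: z_def)
  obtain l where "(\<lambda>n. \<psi> (z n)) \<longlonglongrightarrow> l" "(\<lambda>n. \<psi> (z n + pi * \<i>)) \<longlonglongrightarrow> l"
    using limits_of_line_mass_finite[OF fin] unfolding z_def by blast
  then have "(\<lambda>n. exp (\<psi> (z n))) \<longlonglongrightarrow> exp l" "(\<lambda>n. exp (\<psi> (z n + pi * \<i>))) \<longlonglongrightarrow> exp l"
    by (auto intro: tendsto_exp)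
  then have lim: "(\<lambda>n. \<phi> j (z n)) \<longlonglongrightarrow> exp l" "(\<lambda>n. \<phi> j (z n + pi * \<i>)) \<longlonglongrightarrow> exp l"
    by (simp_all only: exp_eq pos)
  show False
    using classD
  proof
    assume "entire_class_D f N \<Omega> \<tau> \<and> A = UNIV"
    then have "f holomorphic_on UNIV"
      by (simp add: entire_class_D_def)
    then have "isCont f (exp l)"
      by (simp add: holomorphic_on_imp_continuous_on continuous_on_eq_continuous_at[symmetric]
          holomorphic_on_imp_differentiable_at field_differentiable_imp_continuous_at)
    then have "(\<lambda>n. f (\<phi> j (z n))) \<longlonglongrightarrow> f (exp l)" "(\<lambda>n. f (\<phi> j (z n + pi * \<i>))) \<longlonglongrightarrow> f (exp l)"
      using lim isCont_tendsto_compose by blast+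
    moreover have "f (\<phi> j (z n)) = exp 1" for n
    proof -
      have "exp (z n) = exp 1"
        unfolding z_def Complex_Transcendental.exp_eq by blast
      then show ?thesis
        by (simp add: f_phi[OF j pos(1)])
    qed
    moreover have "f (\<phi> j (z n + pi * \<i>)) = - exp 1" for n
    proof -
      have "exp (z n) = exp 1"
        unfolding z_def Complex_Transcendental.exp_eq by blast
      then show ?thesis
        unfolding f_phi[OF j pos(2)] by (simp add: exp_add)
    qed
    ultimately have "(\<lambda>n::nat. exp 1) \<longlonglongrightarrow> f (exp l)" "(\<lambda>n::nat. - exp 1) \<longlonglongrightarrow> f (exp l)"
      by simp_all
    then have "exp 1 = f (exp l)" "- exp 1 = f (exp l)"
      by (simp_all add: LIMSEQ_const_iff)
    then show False
      by simp
  next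
    assume "model_class_D f N \<Omega> \<tau> \<and> A = (\<Union>j<N. \<Omega> j)"
    moreover have "z n \<in> right_half_plane" for n
      using pos by (simp add: right_half_plane_def)
    moreover have "filterlim (\<lambda>n. norm (z n)) at_top sequentially"
    proof (rule filterlim_at_top_mono[OF filterlim_real_sequentially])
      have "real n \<le> norm (z n)" for n
      proof -
        have "real n * 1 \<le> real n * (2 * pi)"
          using pi_gt3 by (intro mult_left_mono) auto
        also have "\<dots> = Im (z n)"
          by (simp add: z_def)
        also have "\<dots> \<le> norm (z n)"
          using abs_Im_le_cmod[of "z n"] by linarith
        finally show ?thesis by simp
      qed
      then show "\<forall>\<^sub>F n in sequentially. real n \<le> norm (z n)"
        by simp
    qed
    ultimately have "filterlim (\<lambda>n. norm (\<phi> j (z n))) at_top sequentially"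
      using j unfolding model_class_D_def by blast
    moreover have "(\<lambda>n. norm (\<phi> j (z n))) \<longlonglongrightarrow> norm (exp l)"
      by (intro tendsto_norm lim)
    ultimately show False
      using not_tendsto_and_filterlim_at_infinity[of sequentially "\<lambda>n. norm (\<phi> j (z n))"]
        filterlim_at_top_imp_at_infinity by auto
  qed
qed

section \<open>The zeros of the spectrum and their maximum\<close>

lemma theta_j_props:
  assumes "negative_spectrum N \<Omega> \<tau>" and j: "j < N"
  shows "0 < theta_j \<Omega> \<tau> j" and "0 < r \<Longrightarrow> b_infty_j \<Omega> \<tau> j r = 0 \<Longrightarrow> theta_j \<Omega> \<tau> j \<le> r"
proof -
  obtain t0 where t0: "0 < t0" "b_infty_j \<Omega> \<tau> j t0 = 0"
    "\<And>s. 0 < s \<Longrightarrow> b_infty_j \<Omega> \<tau> j s = 0 \<Longrightarrow> t0 \<le> s"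
    using assms unfolding negative_spectrum_def spectrum_well_defined_def by blast
  \<comment> \<open>\<open>LEAST\<close> on the reals is meaningful only if the minimum is attained;
    \<open>spectrum_well_defined\<close> supplies it.\<close>
  then have "theta_j \<Omega> \<tau> j = t0"
    unfolding theta_j_def by (intro Least_equality) auto
  with t0 show "0 < theta_j \<Omega> \<tau> j" "0 < r \<Longrightarrow> b_infty_j \<Omega> \<tau> j r = 0 \<Longrightarrow> theta_j \<Omega> \<tau> j \<le> r"
    by auto
qed

lemma Theta_ge: "j < N \<Longrightarrow> theta_j \<Omega> \<tau> j \<le> Theta N \<Omega> \<tau>"
  unfolding Theta_def by (rule Max_ge) auto

lemma Theta_attained:
  obtains j where "j < N" and "Theta N \<Omega> \<tau> = theta_j \<Omega> \<tau> j"
proof -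
  have "Theta N \<Omega> \<tau> \<in> (\<lambda>j. theta_j \<Omega> \<tau> j) ` {..<N}"
    unfolding Theta_def using N_pos by (intro Max_in) auto
  then show thesis
    using that by auto
qed

lemma line_mass_finite_above_Theta:
  assumes neg: "negative_spectrum N \<Omega> \<tau>" and j: "j < N" and \<psi>: "spectral_tract \<psi> \<Omega> \<tau> j M T0"
    and t: "Theta N \<Omega> \<tau> < t"
  shows "emeasure (log_tract.line_mass \<psi> t) UNIV < \<infinity>"
proof -
  interpret spectral_tract \<psi> \<Omega> \<tau> j M T0 by (rule \<psi>)
  have "b_infty_j \<Omega> \<tau> j t \<le> b_infty N \<Omega> \<tau> t"
    unfolding b_infty_def using j by (intro Max_ge) auto
  also have "\<dots> < 0"
    using neg t by (simp add: negative_spectrum_def)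
  finally have "b_infty_j \<Omega> \<tau> j t < 0" .
  moreover have "0 \<le> t"
    using theta_j_props(1)[OF neg j] Theta_ge[OF j] t by linarith
  ultimately show ?thesis
    by (intro line_mass_finite_of_b_infty_neg)
qed

text \<open>If \<open>Theta\<close> were below 1, negative spectrum would make the mass with
  exponent 1 finite. The bound turns the condition on \<open>p\<close> into
  \<open>Theta < t - 1 / p\<close>.\<close>

lemma Theta_ge_one:
  assumes neg: "negative_spectrum N \<Omega> \<tau>"
  shows "1 \<le> Theta N \<Omega> \<tau>"
proof (rule ccontr)
  assume "\<not> 1 \<le> Theta N \<Omega> \<tau>"
  then have "Theta N \<Omega> \<tau> < 1"
    by simp
  moreover obtain \<psi> M T0 where "spectral_tract \<psi> \<Omega> \<tau> 0 M T0"
    using spectral_tract_exists[OF N_pos] by blast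
  ultimately show False
    using line_mass_finite_above_Theta[OF neg N_pos] line_mass_one_infinite[OF N_pos] by blast
qed

section \<open>Convergence, decay and divergence of the series\<close>

lemma summable_on_product_bound:
  fixes a :: "nat \<Rightarrow> int \<Rightarrow> real"
  assumes nonneg: "\<And>j k. j < N \<Longrightarrow> 0 \<le> a j k"
    and B: "\<And>j K. j < N \<Longrightarrow> finite K \<Longrightarrow> (\<Sum>k\<in>K. a j k) \<le> B j"
  shows "(\<lambda>(j, k). a j k) summable_on ({..<N} \<times> UNIV)"
    and "(\<Sum>\<^sub>\<infinity>(j, k)\<in>{..<N} \<times> UNIV. a j k) \<le> (\<Sum>j<N. B j)"
proof -
  have fin: "(\<Sum>(j, k)\<in>F. a j k) \<le> (\<Sum>j<N. B j)" if F: "finite F" "F \<subseteq> {..<N} \<times> UNIV" for F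
  proof -
    \<comment> \<open>A finite set of pairs is enlarged to a rectangle, on which the bounds
      \<open>B j\<close> apply row by row.\<close>
    have "(\<Sum>(j, k)\<in>F. a j k) \<le> (\<Sum>(j, k)\<in>{..<N} \<times> snd ` F. a j k)"
      using F nonneg by (intro sum_mono2) (force+)
    also have "\<dots> = (\<Sum>j<N. \<Sum>k\<in>snd ` F. a j k)"
      by (simp add: sum.cartesian_product)
    also have "\<dots> \<le> (\<Sum>j<N. B j)"
      using F B by (intro sum_mono) auto
    finally show ?thesis .
  qed
  show summ: "(\<lambda>(j, k). a j k) summable_on ({..<N} \<times> UNIV)"
    by (rule nonneg_bdd_above_summable_on) (use nonneg fin in \<open>auto intro!: bdd_aboveI2\<close>)
  show "(\<Sum>\<^sub>\<infinity>(j, k)\<in>{..<N} \<times> UNIV. a j k) \<le> (\<Sum>j<N. B j)"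
    by (rule infsum_le_finite_sums[OF summ]) (rule fin)
qed

text \<open>The exponent is split as \<open>t = s + 1 / p\<close> with \<open>s\<close> still above
  \<open>Theta\<close>. The powers with exponent \<open>s\<close> have uniformly bounded sums on
  \<open>Re \<xi> \<ge> \<gamma>\<close>, and by \<open>deriv_le\<close> the remaining factor is at
  most \<open>(12 * pi / ln (norm w)) powr (1 / p)\<close>.\<close>

lemma transfer_op_decay:
  assumes neg: "negative_spectrum N \<Omega> \<tau>" and t: "Theta N \<Omega> \<tau> < t"
    and \<gamma>: "0 < \<gamma>" and p: "1 < p" "1 / p < t / Theta N \<Omega> \<tau> - 1"
  obtains C where "0 \<le> C" and "\<And>w. exp \<gamma> < norm w \<Longrightarrow>
    transfer_term f t summable_on preimage_in A f w \<and> transfer_op A f t w \<le> C * ln (norm w) powr (- 1 / p)"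
proof -
  define \<Theta> where "\<Theta> = Theta N \<Omega> \<tau>"
  define s where "s = t - 1 / p"
  have \<Theta>: "1 \<le> \<Theta>"
    unfolding \<Theta>_def by (rule Theta_ge_one[OF neg])
  have "1 / p < (t - \<Theta>) / \<Theta>"
    using p \<Theta> by (simp add: \<Theta>_def diff_divide_distrib)
  \<comment> \<open>This is where \<open>1 \<le> \<Theta>\<close> enters.\<close>
  also have "\<dots> \<le> t - \<Theta>"
    using \<Theta> t mult_left_mono[of 1 \<Theta> "t - \<Theta>"] by (simp add: \<Theta>_def pos_divide_le_eq)
  finally have s: "\<Theta> < s" "0 \<le> s"
    using \<Theta> by (auto simp: s_def)
  obtain \<psi> M T0 where \<psi>: "\<And>j. j < N \<Longrightarrow> spectral_tract (\<psi> j) \<Omega> \<tau> j (M j) (T0 j)"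
    using spectral_tract_exists by metis
  have "\<exists>B. 0 \<le> B \<and> (\<forall>\<xi> K :: int set. \<gamma> \<le> Re \<xi> \<longrightarrow> finite K \<longrightarrow>
      (\<Sum>k\<in>K. norm (deriv (\<psi> j) (\<xi> + of_int (2 * k) * pi * \<i>)) powr s) \<le> B)" if j: "j < N" for j
  proof -
    interpret spectral_tract "\<psi> j" \<Omega> \<tau> j "M j" "T0 j" by (rule \<psi>[OF j])
    show ?thesis
      using sum_powr_bounded[OF s(2) \<gamma> line_mass_finite_above_Theta[OF neg j \<psi>[OF j]]] s(1)
      by (simp add: \<Theta>_def)
  qed
  then obtain B where B: "\<And>j. j < N \<Longrightarrow> 0 \<le> B j"
    "\<And>j \<xi> K. j < N \<Longrightarrow> \<gamma> \<le> Re \<xi> \<Longrightarrow> finite (K :: int set) \<Longrightarrow>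
      (\<Sum>k\<in>K. norm (deriv (\<psi> j) (\<xi> + of_int (2 * k) * pi * \<i>)) powr s) \<le> B j"
    by metis
  define C where "C = (12 * pi) powr (1 / p) * (\<Sum>j<N. B j)"
  show thesis
  proof (rule that)
    show "0 \<le> C"
      unfolding C_def using B(1) by (intro mult_nonneg_nonneg sum_nonneg) auto
    fix w :: complex assume w: "exp \<gamma> < norm w"
    have "1 < exp \<gamma>"
      using \<gamma> by simp
    then have w1: "1 < norm w"
      using w by linarith
    then have w0: "w \<noteq> 0"
      by auto
    define x where "x = ln (norm w)"
    have "ln (exp \<gamma>) < x"
      unfolding x_def using w w0 by (subst ln_less_cancel_iff) auto
    then have x: "\<gamma> < x" "0 < x"
      using \<gamma> by auto
    have Re: "Re (Ln w + of_int (2 * k) * pi * \<i>) = x" for k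
      using w0 by (simp add: x_def)
    define c where "c = (12 * pi / x) powr (1 / p)"
    have c_eq: "c = (12 * pi) powr (1 / p) * x powr (- 1 / p)"
      using x by (simp add: c_def powr_divide powr_minus_divide)
    have bound: "(\<Sum>k\<in>K. norm (deriv (\<psi> j) (Ln w + of_int (2 * k) * pi * \<i>)) powr t) \<le> c * B j"
      if j: "j < N" and K: "finite K" for j and K :: "int set"
    proof -
      interpret spectral_tract "\<psi> j" \<Omega> \<tau> j "M j" "T0 j" by (rule \<psi>[OF j])
      have "norm (deriv (\<psi> j) (Ln w + of_int (2 * k) * pi * \<i>)) powr t
          \<le> c * norm (deriv (\<psi> j) (Ln w + of_int (2 * k) * pi * \<i>)) powr s" for k
      proof -
        let ?g = "norm (deriv (\<psi> j) (Ln w + of_int (2 * k) * pi * \<i>))"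
        have "?g \<le> 12 * pi / x"
          using deriv_le[of "Ln w + of_int (2 * k) * pi * \<i>"] x(2) unfolding Re by simp
        then have "?g powr (1 / p) \<le> c"
          unfolding c_def using p by (intro powr_mono2) auto
        then have "?g powr (1 / p) * ?g powr s \<le> c * ?g powr s"
          by (intro mult_right_mono) auto
        then show ?thesis
          by (simp add: s_def flip: powr_add)
      qed
      then have "(\<Sum>k\<in>K. norm (deriv (\<psi> j) (Ln w + of_int (2 * k) * pi * \<i>)) powr t)
          \<le> c * (\<Sum>k\<in>K. norm (deriv (\<psi> j) (Ln w + of_int (2 * k) * pi * \<i>)) powr s)"
        unfolding sum_distrib_left by (intro sum_mono)
      also have "\<dots> \<le> c * B j"
        using B(2)[OF j _ K, of "Ln w"] x Re[of 0] by (intro mult_left_mono) (auto simp: c_def)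
      finally show ?thesis .
    qed
    have "(\<Sum>j<N. c * B j) = C * ln (norm w) powr (- 1 / p)"
      unfolding C_def c_eq x_def by (simp add: sum_distrib_left sum_distrib_right mult_ac)
    then show "transfer_term f t summable_on preimage_in A f w \<and> transfer_op A f t w \<le> C * ln (norm w) powr (- 1 / p)"
      using summable_on_product_bound[of "\<lambda>j k. norm (deriv (\<psi> j) (Ln w + of_int (2 * k) * pi * \<i>)) powr t" "\<lambda>j. c * B j"]
        bound transfer_summable_iff[OF w1 \<psi>, of t] by simp
  qed
qed

text \<open>The closed union of tracts has positive distance \<open>d\<close> from the compact unit
  disc, so \<open>ln (norm w)\<close> is bounded away from 0 on it and the decay estimate gives a
  uniform bound.\<close>

lemma transfer_op_bounded:
  assumes neg: "negative_spectrum N \<Omega> \<tau>" and t: "Theta N \<Omega> \<tau> < t"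
  shows "\<exists>B. \<forall>w \<in> closure (\<Union>j<N. \<Omega> j).
      transfer_term f t summable_on preimage_in A f w \<and> transfer_op A f t w \<le> B"
proof -
  have "closure (\<Union>j<N. \<Omega> j) \<inter> cball 0 1 = {}"
    using common by (simp add: class_D_common_def)
  then obtain d where d: "0 < d" "\<And>x y. x \<in> closure (\<Union>j<N. \<Omega> j) \<Longrightarrow> y \<in> cball 0 1 \<Longrightarrow> d \<le> dist x y"
    using separate_closed_compact[OF closed_closure compact_cball] by metis
  have away: "1 + d \<le> norm w" if "w \<in> closure (\<Union>j<N. \<Omega> j)" for w
  proof -
    have w: "1 < norm w"
      using norm_closure[OF that] .
    \<comment> \<open>\<open>sgn w\<close> is the point of the closed disc nearest to
      \<open>w\<close>, at distance \<open>norm w - 1\<close>.\<close>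
    then have "w = of_real (norm w) * sgn w"
      by (auto simp: sgn_eq)
    then have "w - sgn w = of_real (norm w - 1) * sgn w"
      by (simp add: left_diff_distrib)
    then have "dist w (sgn w) = norm w - 1"
      using w by (auto simp: dist_norm norm_mult norm_sgn simp del: of_real_diff)
    moreover have "d \<le> dist w (sgn w)"
      by (rule d(2)[OF that]) (simp add: norm_sgn)
    ultimately show ?thesis by simp
  qed
  \<comment> \<open>Half of the logarithm makes \<open>exp \<gamma> < 1 + d\<close> strict, as the
    decay estimate demands.\<close>
  define \<gamma> where "\<gamma> = ln (1 + d) / 2"
  have \<gamma>: "0 < \<gamma>" "\<gamma> < ln (1 + d)"
    using d by (auto simp: \<gamma>_def)
  define q where "q = t / Theta N \<Omega> \<tau> - 1"
  have q: "0 < q"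
    using Theta_ge_one[OF neg] t by (simp add: q_def less_divide_eq)
  \<comment> \<open>The entry \<open>2 / q\<close> forces \<open>1 / p \<le> q / 2\<close>, which is
    below \<open>q\<close>.\<close>
  define p where "p = max 2 (2 / q)"
  have p: "1 < p" "1 / p < q"
  proof -
    show "1 < p"
      by (simp add: p_def)
    have "1 / p \<le> 1 / (2 / q)"
      using q by (intro divide_left_mono) (auto simp: p_def)
    then show "1 / p < q"
      using q by simp
  qed
  obtain C where C: "0 \<le> C" "\<And>w. exp \<gamma> < norm w \<Longrightarrow>
    transfer_term f t summable_on preimage_in A f w \<and> transfer_op A f t w \<le> C * ln (norm w) powr (- 1 / p)"
    using transfer_op_decay[OF neg t \<gamma>(1) p[unfolded q_def]] by blast
  have "transfer_term f t summable_on preimage_in A f w \<and> transfer_op A f t w \<le> C * \<gamma> powr (- 1 / p)"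
    if w: "w \<in> closure (\<Union>j<N. \<Omega> j)" for w
  proof -
    have "exp \<gamma> < 1 + d"
      using \<gamma> d by (metis exp_less_cancel_iff exp_ln add_pos_pos zero_less_one)
    then have ew: "exp \<gamma> < norm w"
      using away[OF w] by linarith
    then have "\<gamma> < ln (norm w)"
      by (metis exp_gt_zero exp_less_cancel_iff exp_ln less_trans)
    then have "ln (norm w) powr (- 1 / p) \<le> \<gamma> powr (- 1 / p)"
      using \<gamma> p by (intro powr_mono2') auto
    then have "C * ln (norm w) powr (- 1 / p) \<le> C * \<gamma> powr (- 1 / p)"
      using C(1) by (rule mult_left_mono)
    with C(2)[OF ew] show ?thesis
      by auto
  qed
  then show ?thesis by blast
qed

text \<open>For a tract with \<open>theta_j = Theta\<close>, convergence of the whole series bounds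
  the sums over this tract. The mass is then finite for an exponent below \<open>theta_j\<close>,
  which produces a zero of the spectrum before the smallest one.\<close>

lemma transfer_not_summable:
  assumes neg: "negative_spectrum N \<Omega> \<tau>" and t: "t < Theta N \<Omega> \<tau>" and w: "w \<in> (\<Union>j<N. \<Omega> j)"
  shows "\<not> transfer_term f t summable_on preimage_in A f w"
proof
  assume summ: "transfer_term f t summable_on preimage_in A f w"
  have w1: "1 < norm w"
    by (rule norm_closure[OF subsetD[OF closure_subset w]])
  then have w0: "w \<noteq> 0"
    by auto
  define x where "x = ln (norm w)"
  have x: "0 < x"
    using w1 by (simp add: x_def ln_gt_zero)
  have Re: "Re (Ln w + of_int (2 * k) * pi * \<i>) = x" for k
    using w0 by (simp add: x_def)
  obtain j where j: "j < N" "Theta N \<Omega> \<tau> = theta_j \<Omega> \<tau> j"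
    by (rule Theta_attained)
  obtain \<psi> M T0 where \<psi>: "\<And>j. j < N \<Longrightarrow> spectral_tract (\<psi> j) \<Omega> \<tau> j (M j) (T0 j)"
    using spectral_tract_exists by metis
  interpret spectral_tract "\<psi> j" \<Omega> \<tau> j "M j" "T0 j" by (rule \<psi>[OF j(1)])
  define g where "g k = norm (deriv (\<psi> j) (Ln w + of_int (2 * k) * pi * \<i>))" for k :: int
  define a where "a = (\<lambda>(j, k :: int). norm (deriv (\<psi> j) (Ln w + of_int (2 * k) * pi * \<i>)) powr t)"
  have a_summ: "a summable_on ({..<N} \<times> UNIV)"
    using summ transfer_summable_iff(1)[OF w1 \<psi>, of t] by (simp add: a_def)
  define S where "S = infsum a ({..<N} \<times> UNIV)"
  have sum_t: "(\<Sum>k\<in>K. g k powr t) \<le> S" if "finite K" for K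
  proof -
    have "(\<Sum>k\<in>K. g k powr t) = sum a (Pair j ` K)"
      by (subst sum.reindex) (auto simp: inj_on_def a_def g_def)
    also have "\<dots> \<le> S"
      unfolding S_def
      by (rule finite_sum_le_infsum[OF a_summ]) (use that j in \<open>auto simp: a_def\<close>)
    finally show ?thesis .
  qed
  \<comment> \<open>As \<open>t\<close> may be negative, it is raised to a positive exponent that is
    still below \<open>theta_j\<close>. Raising is harmless: the numbers \<open>g k\<close> are
    bounded by \<open>12 * pi / x\<close>, so their additional power is a bounded factor.\<close>
  define r where "r = max t (theta_j \<Omega> \<tau> j / 2)"
  have r: "0 < r" "t \<le> r" "r < theta_j \<Omega> \<tau> j"
    using theta_j_props(1)[OF neg j(1)] t j(2) by (auto simp: r_def less_max_iff_disj)
  have "(\<Sum>k\<in>K. g k powr r) \<le> (12 * pi / x) powr (r - t) * S" if K: "finite K" for K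
  proof -
    have "g k powr r \<le> (12 * pi / x) powr (r - t) * g k powr t" for k
    proof -
      have "g k \<le> 12 * pi / x"
        using deriv_le[of "Ln w + of_int (2 * k) * pi * \<i>"] x unfolding Re g_def by simp
      then have "g k powr (r - t) \<le> (12 * pi / x) powr (r - t)"
        using r by (intro powr_mono2) (auto simp: g_def)
      then have "g k powr (r - t) * g k powr t \<le> (12 * pi / x) powr (r - t) * g k powr t"
        by (intro mult_right_mono) auto
      then show ?thesis
        by (simp flip: powr_add)
    qed
    then have "(\<Sum>k\<in>K. g k powr r) \<le> (12 * pi / x) powr (r - t) * (\<Sum>k\<in>K. g k powr t)"
      unfolding sum_distrib_left by (intro sum_mono)
    also have "\<dots> \<le> (12 * pi / x) powr (r - t) * S"
      by (intro mult_left_mono sum_t K) auto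
    finally show ?thesis .
  qed
  then have "emeasure (line_mass r) UNIV < \<infinity>"
    using x Re[of 0] r by (intro line_mass_finite[where \<xi> = "Ln w"]) (auto simp: g_def)
  then obtain r' where "0 < r'" "r' \<le> r" "b_infty_j \<Omega> \<tau> j r' = 0"
    using b_infty_zero_of_line_mass_finite r by (metis less_imp_le)
  then have "theta_j \<Omega> \<tau> j \<le> r"
    using theta_j_props(2)[OF neg j(1)] by force
  then show False
    using r by simp
qed

end

theorem theorem4p4:
  fixes f :: "complex \<Rightarrow> complex" and N :: nat and \<Omega> :: "nat \<Rightarrow> complex set"
    and \<tau> :: "nat \<Rightarrow> complex \<Rightarrow> complex" and A :: "complex set"
  assumes classD: "(entire_class_D f N \<Omega> \<tau> \<and> A = UNIV) \<or>
                   (model_class_D f N \<Omega> \<tau> \<and> A = (\<Union>j<N. \<Omega> j))"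
    and negspec: "negative_spectrum N \<Omega> \<tau>"
  shows "(\<forall>t > Theta N \<Omega> \<tau>.
            (\<exists>B. \<forall>w \<in> closure (\<Union>j<N. \<Omega> j).
                 transfer_term f t summable_on preimage_in A f w \<and> transfer_op A f t w \<le> B) \<and>
            (\<forall>\<gamma> p. 0 < \<gamma> \<and> \<gamma> < 1 \<and> 1 < p \<and> 1 / p < t / Theta N \<Omega> \<tau> - 1 \<longrightarrow>
               (\<exists>C. \<forall>w. norm w > exp \<gamma> \<longrightarrow>
                  transfer_term f t summable_on preimage_in A f w \<and>
                  transfer_op A f t w \<le> C * ln (norm w) powr (- 1 / p))))
       \<and> (\<forall>t < Theta N \<Omega> \<tau>. \<forall>w \<in> (\<Union>j<N. \<Omega> j).
            \<not> (transfer_term f t summable_on preimage_in A f w))"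
proof -
  interpret class_D_tracts f N \<Omega> \<tau> A
    by unfold_locales (rule classD)
  have "\<exists>C. \<forall>w. norm w > exp \<gamma> \<longrightarrow>
      transfer_term f t summable_on preimage_in A f w \<and> transfer_op A f t w \<le> C * ln (norm w) powr (- 1 / p)"
    if "Theta N \<Omega> \<tau> < t" "0 < \<gamma>" "1 < p" "1 / p < t / Theta N \<Omega> \<tau> - 1" for t \<gamma> p
    using transfer_op_decay[OF negspec that] by metis
  with transfer_op_bounded[OF negspec] transfer_not_summable[OF negspec] show ?thesis
    by blast
qed

end
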